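(* Let $\mathcal S$ be a finite set, $\mu=(\mu_r)_{r\in\mathcal S}$ a probability vector with all $\mu_r>0$, and $\kappa$ an irreducible nonnegative symmetric matrix on $\mathcal S$. Let $\lambda_0=\sum_{r\in\mathcal S}\mu_r\,\delta_{\delta_r}$ and, for $t\in(0,\infty)$, let $\lambda_t$ be the measure on $\mathcal M_{\mathbb N_0}(\mathcal S)$ given by $\lambda_t=\lambda^{(t)}_{\mu}$ if $\Sigma(t\kappa,\mu)\le1$ and $\lambda_t=\lambda^{(t)}_{c^*(t)}$ if $\Sigma(t\kappa,\mu)>1$, where $c^*(t)$ is the unique $c$ with $e^{-t(\kappa c)_r}c_r=e^{-t(\kappa\mu)_r}\mu_r$ for all $r\in\mathcal S$, $c\le\mu$ and $c\ne\mu$. Then $t\mapsto\lambda_t$ is a solution on $[0,\infty)$, with initial condition $\lambda_0$, of the Flory equation: for every test function $f\in\mathcal C_c(\mathcal M_{\mathbb N_0}(\mathcal S))$, $$\begin{aligned}\frac{\mathrm d}{\mathrm dt}\int f(k)\,\lambda_t(\mathrm dk)&=\frac12\iint f(k+\widetilde k)K(k,\widetilde k)\,\lambda_t(\mathrm dk)\lambda_t(\mathrm d\widetilde k)-\iint f(k)K(k,\widetilde k)\,\lambda_t(\mathrm dk)\lambda_t(\mathrm d\widetilde k)\\&\quad-\iint f(k)K(k,\widetilde k)\,\lambda_t(\mathrm dk)\,(\lambda_0-\lambda_t)(\mathrm d\widetilde k),\end{aligned}$$ all integrals being over $\mathcal M_{\mathbb N_0}(\mathcal S)$ (resp. its square),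 where $K(k,\widetilde k)=\sum_{r,s\in\mathcal S}\kappa(r,s)k_r\widetilde k_s$.
   Context: $\mathcal M_{\mathbb N_0}(\mathcal S)$ is identified with $\mathbb N_0^{\mathcal S}$ (discrete topology, so $\mathcal C_c$ means finitely supported functions); $\delta_r$ is identified with the unit vector at $r$; $|k|=\sum_rk_r$; $(\kappa c)_r=\sum_s\kappa(r,s)c_s$; $c\le\mu$ is componentwise. $\Sigma(\kappa,\nu)$ is the operator norm on $L^2(\nu)$ of $f\mapsto\big(\sum_s\kappa(r,s)f(s)\nu_s\big)_r$ (equivalently the spectral radius of the matrix $(\kappa(r,s)\nu_s)_{r,s}$). For $c\in[0,\infty)^{\mathcal S}$ and $t>0$, $\lambda^{(t)}_c$ is the measure with $$\lambda^{(t)}_c(k)=\tau_t(k)\prod_{s\in\mathcal S}\frac{\big(c_se^{-t(\kappa c)_s}\big)^{k_s}}{k_s!},\qquad k\in\mathbb N_0^{\mathcal S},$$ where for $k\ne 0$, $\tau_t(k)=\sum_{T}\prod_{\{i,j\}\in E(T)}t\,\kappa(x_i,x_j)$, the sum over all spanning trees $T$ on $\{1,\dots,|k|\}$ and $(x_1,\dots,x_{|k|})$ any vector of types containing each $r\in\mathcal S$ exactly $k_r$ times, and $\tau_t(0)=0$. ($\lambda_t$ is the first component of the unique minimizer of the large-deviations rate function of the microscopic and macroscopic component statistics of the inhomogeneous random graph with limiting kernel $t\kappa$ and limiting type distribution $\mu$.) *)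

theory Defs
  imports "HOL-Analysis.Analysis"
begin

text \<open>The finite set of types is the universe of a finite type \<open>'s\<close>; elements of
  \<open>\<nat>\<^sub>0\<^sup>S\<close> are vectors of type \<open>nat^'s\<close>, with \<open>axis r 1\<close> the unit vector at \<open>r\<close>.\<close>

text \<open>Not permutation-similar to a block triangular matrix. For a one-element type this holds for
  every matrix, the zero matrix included.\<close>

definition irreducible_matrix :: "real^'s^'s \<Rightarrow> bool" where
  "irreducible_matrix A \<longleftrightarrow>
     \<not> (\<exists>I. I \<noteq> {} \<and> I \<noteq> UNIV \<and> (\<forall>r\<in>I. \<forall>s\<in>- I. A $ r $ s = 0))"

definition l2_norm_wrt :: "real^'s::finite \<Rightarrow> real^'s \<Rightarrow> real" where
  "l2_norm_wrt \<nu> f = sqrt (\<Sum>s\<in>UNIV. (f $ s)\<^sup>2 * \<nu> $ s)"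

definition kernel_operator :: "real^'s^'s::finite \<Rightarrow> real^'s \<Rightarrow> real^'s \<Rightarrow> real^'s" where
  "kernel_operator \<kappa> \<nu> f = (\<chi> r. \<Sum>s\<in>UNIV. \<kappa> $ r $ s * f $ s * \<nu> $ s)"

text \<open>Same shape as \<^const>\<open>onorm\<close>, which cannot be used because the norm depends on \<open>\<nu>\<close>.\<close>

definition Sigma_norm :: "real^'s^'s::finite \<Rightarrow> real^'s \<Rightarrow> real" where
  "Sigma_norm \<kappa> \<nu> =
     (SUP f. l2_norm_wrt \<nu> (kernel_operator \<kappa> \<nu> f) / l2_norm_wrt \<nu> f)"

text \<open>A graph on a vertex set \<open>V\<close> is given by its set of edges, each a two-element subset of \<open>V\<close>.\<close>

definition graph_connected :: "'a set \<Rightarrow> 'a set set \<Rightarrow> bool" where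
  "graph_connected V E \<longleftrightarrow> (\<forall>i\<in>V. \<forall>j\<in>V. (\<lambda>a b. {a, b} \<in> E)\<^sup>*\<^sup>* i j)"

definition graph_cycle :: "'a set set \<Rightarrow> 'a list \<Rightarrow> bool" where
  "graph_cycle E p \<longleftrightarrow> length p \<ge> 3 \<and> distinct p \<and>
     (\<forall>i<length p. {p ! i, p ! (Suc i mod length p)} \<in> E)"

definition spanning_trees :: "'a set \<Rightarrow> 'a set set set" where
  "spanning_trees V = {E. (\<forall>e\<in>E. e \<subseteq> V \<and> card e = 2) \<and>
     graph_connected V E \<and> \<not> (\<exists>p. graph_cycle E p)}"

text \<open>\<open>x\<close> is a vector of types of length \<open>|k|\<close> containing each \<open>r\<close> exactly \<open>k\<^sub>r\<close> times.\<close>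

definition has_type_counts :: "nat^'s::finite \<Rightarrow> (nat \<Rightarrow> 's) \<Rightarrow> bool" where
  "has_type_counts k x \<longleftrightarrow>
     (\<forall>r. card {i \<in> {1..(\<Sum>s\<in>UNIV. k $ s)}. x i = r} = k $ r)"

text \<open>The endpoints of an edge \<open>e\<close> are \<open>Min e\<close> and \<open>Max e\<close>; their order is immaterial for
  symmetric \<open>\<kappa>\<close>. For such \<open>\<kappa>\<close> the sum does not depend on the choice of \<open>x\<close>, since two
  choices differ by a permutation of the vertices.\<close>

definition tree_weight :: "real^'s^'s::finite \<Rightarrow> real \<Rightarrow> nat^'s \<Rightarrow> real" where
  "tree_weight \<kappa> t k =
     (if k = 0 then 0
      else (let x = (SOME x. has_type_counts k x)
            in \<Sum>T\<in>spanning_trees {1..(\<Sum>s\<in>UNIV. k $ s)}.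
                 \<Prod>e\<in>T. t * \<kappa> $ x (Min e) $ x (Max e)))"

definition cluster_weight :: "real^'s^'s::finite \<Rightarrow> real \<Rightarrow> real^'s \<Rightarrow> nat^'s \<Rightarrow> real" where
  "cluster_weight \<kappa> t c k =
     tree_weight \<kappa> t k *
     (\<Prod>s\<in>UNIV. (c $ s * exp (- t * (\<kappa> *v c) $ s)) ^ (k $ s) / fact (k $ s))"

definition cluster_measure :: "real^'s^'s::finite \<Rightarrow> real \<Rightarrow> real^'s \<Rightarrow> (nat^'s) measure" where
  "cluster_measure \<kappa> t c = point_measure UNIV (\<lambda>k. ennreal (cluster_weight \<kappa> t c k))"

definition is_dual_vector :: "real^'s^'s::finite \<Rightarrow> real^'s \<Rightarrow> real \<Rightarrow> real^'s \<Rightarrow> bool" where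
  "is_dual_vector \<kappa> \<mu> t c \<longleftrightarrow>
     (\<forall>r. 0 \<le> c $ r) \<and>
     (\<forall>r. exp (- t * (\<kappa> *v c) $ r) * c $ r = exp (- t * (\<kappa> *v \<mu>) $ r) * \<mu> $ r) \<and>
     (\<forall>r. c $ r \<le> \<mu> $ r) \<and> c \<noteq> \<mu>"

definition flory_initial :: "real^'s::finite \<Rightarrow> (nat^'s) measure" where
  "flory_initial \<mu> =
     point_measure UNIV (\<lambda>k. ennreal (\<Sum>r\<in>UNIV. \<mu> $ r * indicator {axis r 1} k))"

definition flory_measure :: "real^'s^'s::finite \<Rightarrow> real^'s \<Rightarrow> real \<Rightarrow> (nat^'s) measure" where
  "flory_measure \<kappa> \<mu> t =
     (if t = 0 then flory_initial \<mu>
      else if Sigma_norm (t *\<^sub>R \<kappa>) \<mu> \<le> 1 then cluster_measure \<kappa> t \<mu>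
      else cluster_measure \<kappa> t (THE c. is_dual_vector \<kappa> \<mu> t c))"

definition coag_kernel :: "real^'s^'s::finite \<Rightarrow> nat^'s \<Rightarrow> nat^'s \<Rightarrow> real" where
  "coag_kernel \<kappa> k k' = (\<Sum>r\<in>UNIV. \<Sum>s\<in>UNIV. \<kappa> $ r $ s * real (k $ r) * real (k' $ s))"

text \<open>Every function on the discrete space \<open>nat^'s\<close> is continuous, and its compact sets are the
  finite ones. The integral against the signed measure \<open>\<lambda>\<^sub>0 - \<lambda>\<^sub>t\<close> is the difference of the two
  integrals. Integrability is part of the notion of solution, because the Bochner integral of a
  non-integrable function is \<open>0\<close> by convention. At \<open>t = 0\<close> the derivative is one-sided.\<close>

definition flory_solution ::
  "real^'s^'s::finite \<Rightarrow> (nat^'s) measure \<Rightarrow> (real \<Rightarrow> (nat^'s) measure) \<Rightarrow> bool" where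
  "flory_solution \<kappa> L0 L \<longleftrightarrow>
     L 0 = L0 \<and>
     (\<forall>f :: nat^'s \<Rightarrow> real. finite {k. f k \<noteq> 0} \<longrightarrow> (\<forall>t\<ge>0.
        integrable (L t) f \<and>
        integrable (L t \<Otimes>\<^sub>M L t) (\<lambda>(k, k'). f (k + k') * coag_kernel \<kappa> k k') \<and>
        integrable (L t \<Otimes>\<^sub>M L t) (\<lambda>(k, k'). f k * coag_kernel \<kappa> k k') \<and>
        integrable (L t \<Otimes>\<^sub>M L0) (\<lambda>(k, k'). f k * coag_kernel \<kappa> k k') \<and>
        ((\<lambda>u. \<integral>k. f k \<partial>L u) has_real_derivative
           1 / 2 * (\<integral>(k, k'). f (k + k') * coag_kernel \<kappa> k k' \<partial>(L t \<Otimes>\<^sub>M L t))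
           - (\<integral>(k, k'). f k * coag_kernel \<kappa> k k' \<partial>(L t \<Otimes>\<^sub>M L t))
           - ((\<integral>(k, k'). f k * coag_kernel \<kappa> k k' \<partial>(L t \<Otimes>\<^sub>M L0))
              - (\<integral>(k, k'). f k * coag_kernel \<kappa> k k' \<partial>(L t \<Otimes>\<^sub>M L t))))
          (at t within {0..})))"

end

theory Submission
  imports Defs "HOL-Library.Transitive_Closure_Table"
begin

text \<open>
  Since \<open>c exp (- t \<kappa> c) = \<mu> exp (- t \<kappa> \<mu>)\<close> for the dual vector \<open>c\<close>, the weights of
  \<open>\<lambda>\<^sub>t\<close> have the same closed form before and after gelation, namely
  \<open>t ^ (|k| - 1) exp (- t K(k, \<mu>))\<close> times a constant in \<open>t\<close>. Because the Flory equation lets the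
  lost mass react as well, the loss term is linear, and the equation reduces for each \<open>k\<close> to a
  quadratic recursion for the tree sums, which is obtained by counting trees with a marked
  oriented edge in two ways. The only analytic point is the integrability of \<open>K\<close>: the first
  moment of the components of size at most \<open>n\<close> is nonincreasing in \<open>t\<close>, by induction on \<open>n\<close>.

  The dual vector corresponds to the survival probability \<open>q = 1 - c / \<mu>\<close> of a multitype
  branching process, a nonzero solution of \<open>q = 1 - exp (- t \<kappa> (\<mu> q))\<close>. It exists because a small
  multiple of a Perron eigenfunction is a subsolution, and it is unique by comparing the maximal
  ratio of two solutions.
\<close>

section \<open>Trees and bridges\<close>

text \<open>The two integrals of \<open>f k * K(k, l)\<close> against
  \<open>\<lambda>\<^sub>t\<close> in both variables cancel, and \<open>\<lambda>\<^sub>0\<close>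
  has first moments \<mu>, so \<open>k\<close> is lost at rate \<open>K(k, \<mu>)\<close>: exactly
  what differentiating the exponential gives. The derivative of \<open>t ^ (|k| - 1)\<close> must
  then be half the gain. A tree on \<open>|k|\<close> vertices has \<open>2 (|k| - 1)\<close>
  oriented edges, and cutting one leaves \<open>(|j| - 1) + (|l| - 1) = |k| - 2\<close> edges, which
  produces both the factor 1/2 and the right power of \<open>t\<close>. Cutting and gluing trees is
  easiest when a tree is a connected graph in which every edge is a bridge, so acyclicity is recast
  in that form.

  Above the threshold the first moment of \<open>\<lambda>\<^sub>t\<close> drops below \<mu>, so
  integrability cannot rest on conservation of mass; an inequality for truncated moments covers both
  regimes.

  Irreducibility makes every nonzero survival vector positive in all coordinates, so that ratios of
  two of them can be formed.\<close>

abbreviation connected_in :: "'a set set \<Rightarrow> 'a \<Rightarrow> 'a \<Rightarrow> bool" where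
  "connected_in E \<equiv> (\<lambda>a b. {a, b} \<in> E)\<^sup>*\<^sup>*"

lemma connected_in_sym: "connected_in E a b \<Longrightarrow> connected_in E b a"
proof -
  have "symp (\<lambda>a b. {a, b} \<in> E)" by (auto intro: sympI simp: insert_commute)
  then show "connected_in E a b \<Longrightarrow> connected_in E b a"
    by (rule symp_rtranclp [THEN sympD])
qed

lemma connected_in_mono: "connected_in E a b \<Longrightarrow> E \<subseteq> F \<Longrightarrow> connected_in F a b"
  by (erule rtranclp_mono[THEN predicate2D, rotated]) auto

lemma connected_in_closed:
  assumes "connected_in E a b" "a \<in> A" "\<And>x y. {x, y} \<in> E \<Longrightarrow> x \<in> A \<Longrightarrow> y \<in> A"
  shows "b \<in> A"
  using assms(1,2) by (induction) (auto intro: assms(3))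

text \<open>A walk started in a set closed under adjacency never leaves it, so it uses only edges
  inside the set. This gives connectedness of each side of a cut tree.\<close>

lemma connected_in_restrict:
  assumes "connected_in E a b" "a \<in> A" "\<And>x y. {x, y} \<in> E \<Longrightarrow> x \<in> A \<Longrightarrow> y \<in> A"
  shows "connected_in {e \<in> E. e \<subseteq> A} a b"
  using assms(1)
proof induction
  case (step y z)
  have "y \<in> A" by (rule connected_in_closed[OF step.hyps(1) assms(2,3)])
  with step assms(3)[of y z] have "{y, z} \<in> {e \<in> E. e \<subseteq> A}" by auto
  with step.IH show ?case by (rule rtranclp.rtrancl_into_rtrancl)
qed auto

text \<open>Form of acyclicity that survives cutting and gluing without any handling of cyclic
  lists. The condition \<open>a \<noteq> b\<close> ignores singleton edges, as does
  \<open>graph_cycle\<close> with its length of at least 3.\<close>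

definition bridges_only :: "'a set set \<Rightarrow> bool" where
  "bridges_only E \<longleftrightarrow> (\<forall>a b. {a, b} \<in> E \<longrightarrow> a \<noteq> b \<longrightarrow> \<not> connected_in (E - {{a, b}}) a b)"

lemma bridges_onlyD: "bridges_only E \<Longrightarrow> {a, b} \<in> E \<Longrightarrow> a \<noteq> b \<Longrightarrow> \<not> connected_in (E - {{a, b}}) a b"
  unfolding bridges_only_def by blast

lemma rtrancl_path_nth:
  assumes "rtrancl_path r x xs y" "i < length xs"
  shows "r ((x # xs) ! i) (xs ! i)"
  using assms by (induction arbitrary: i) (auto simp: less_Suc_eq_0_disj)

lemma rtrancl_path_last:
  "rtrancl_path r x xs y \<Longrightarrow> (x # xs) ! length xs = y"
  by (induction rule: rtrancl_path.induct) auto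

text \<open>Traversing a cycle from its first to its last vertex avoids the closing edge, which is
  therefore no bridge. Conversely, a simple path joining the ends of an edge without using that edge
  closes up to a cycle.\<close>

lemma acyclic_iff_bridges_only: "(\<exists>p. graph_cycle E p) \<longleftrightarrow> \<not> bridges_only E"
proof
  assume "\<exists>p. graph_cycle E p"
  then obtain p where p: "graph_cycle E p" by blast
  define n where "n = length p"
  have n: "n \<ge> 3" and dist: "distinct p"
    and edge: "\<And>i. i < n \<Longrightarrow> {p ! i, p ! (Suc i mod n)} \<in> E"
    using p unfolding graph_cycle_def n_def by auto
  let ?a = "p ! 0" and ?b = "p ! (n - 1)"
  have inj: "p ! i = p ! j \<longleftrightarrow> i = j" if "i < n" "j < n" for i j
    using that dist by (simp add: nth_eq_iff_index_eq n_def)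
  have "i < n \<Longrightarrow> connected_in (E - {{?a, ?b}}) ?a (p ! i)" for i
  proof (induction i)
    case (Suc i)
    have e: "{p ! i, p ! Suc i} \<in> E" using edge[of i] Suc.prems by simp
    \<comment> \<open>With \<open>n = 2\<close> the first edge would be the closing edge
      itself.\<close>
    have "{p ! i, p ! Suc i} \<noteq> {?a, ?b}"
      using Suc.prems n by (auto simp: doubleton_eq_iff inj)
    with e have "{p ! i, p ! Suc i} \<in> E - {{?a, ?b}}" by simp
    with Suc show ?case by (meson Suc_lessD rtranclp.rtrancl_into_rtrancl)
  qed auto
  moreover have "{?a, ?b} \<in> E" using edge[of "n - 1"] n by (simp add: insert_commute)
  moreover have "?a \<noteq> ?b" using n by (simp add: inj)
  moreover have "n - 1 < n" using n by simp
  ultimately have "connected_in (E - {{?a, ?b}}) ?a ?b" "{?a, ?b} \<in> E" "?a \<noteq> ?b" by blast+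
  then show "\<not> bridges_only E" unfolding bridges_only_def by blast
next
  assume "\<not> bridges_only E"
  then obtain a b where e: "{a, b} \<in> E" and ne: "a \<noteq> b"
    and c: "connected_in (E - {{a, b}}) a b"
    unfolding bridges_only_def by blast
  let ?r = "\<lambda>x y. {x, y} \<in> E - {{a, b}}"
  from c obtain xs0 where "rtrancl_path ?r a xs0 b"
    by (auto simp: rtranclp_eq_rtrancl_path)
  then obtain xs where path: "rtrancl_path ?r a xs b" and d: "distinct (a # xs)"
    by (rule rtrancl_path_distinct)
  have last: "(a # xs) ! length xs = b" by (rule rtrancl_path_last[OF path])
  \<comment> \<open>\<open>xs\<close> omits the start \<open>a\<close>, so the cycle has
    \<open>length xs + 1\<close> vertices. An empty \<open>xs\<close> would force
    \<open>a = b\<close>, and a single step would be the deleted edge.\<close>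
  have len: "length xs \<ge> 2"
  proof (rule ccontr)
    assume "\<not> length xs \<ge> 2"
    then consider "xs = []" | y where "xs = [y]"
      by (cases xs; cases "tl xs") auto
    then show False using path ne
      by cases (auto elim: rtrancl_path.cases)
  qed
  have "graph_cycle E (a # xs)"
    unfolding graph_cycle_def
  proof (intro conjI allI impI)
    fix i assume i: "i < length (a # xs)"
    show "{(a # xs) ! i, (a # xs) ! (Suc i mod length (a # xs))} \<in> E"
    proof (cases "i = length xs")
      case True
      then show ?thesis using last e by (simp add: insert_commute)
    next
      case False
      then have "i < length xs" using i by simp
      with rtrancl_path_nth[OF path this] show ?thesis by simp
    qed
  qed (use len d in auto)
  then show "\<exists>p. graph_cycle E p" ..
qed

section \<open>Cutting a tree at an edge and gluing two trees\<close>

lemma spanning_trees_iff: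
  "T \<in> spanning_trees V \<longleftrightarrow>
     (\<forall>e\<in>T. e \<subseteq> V \<and> card e = 2) \<and> graph_connected V T \<and> bridges_only T"
  unfolding spanning_trees_def by (simp add: acyclic_iff_bridges_only)

lemma spanning_trees_subset_Pow: "spanning_trees V \<subseteq> Pow (Pow V)"
  by (auto simp: spanning_trees_def)

lemma finite_spanning_trees: "finite V \<Longrightarrow> finite (spanning_trees V)"
  by (rule finite_subset[OF spanning_trees_subset_Pow]) simp

lemma bridges_only_mono:
  assumes "bridges_only F" "E \<subseteq> F" shows "bridges_only E"
  unfolding bridges_only_def
proof (intro allI impI notI)
  fix a b assume e: "{a, b} \<in> E" "a \<noteq> b" and c: "connected_in (E - {{a, b}}) a b"
  have "connected_in (F - {{a, b}}) a b"
    by (rule connected_in_mono[OF c]) (use assms(2) in blast)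
  moreover have "{a, b} \<in> F" using e assms(2) by blast
  ultimately show False using bridges_onlyD[OF assms(1) _ e(2)] by blast
qed

lemma graph_connected_from_hub:
  assumes "\<And>v. v \<in> V \<Longrightarrow> connected_in E w v" shows "graph_connected V E"
  unfolding graph_connected_def
proof (intro ballI)
  fix i j assume "i \<in> V" "j \<in> V"
  then have "connected_in E i w" "connected_in E w j"
    using assms connected_in_sym by fast+
  then show "connected_in E i j" by (rule rtranclp_trans)
qed

text \<open>The order of the endpoints matters: this is the side of \<open>a\<close>, so an oriented
  edge determines an ordered pair of sides.\<close>

definition edge_component :: "'a set set \<Rightarrow> 'a \<Rightarrow> 'a \<Rightarrow> 'a set" where
  "edge_component T a b = {v. connected_in (T - {{a, b}}) a v}"

text \<open>No remaining edge joins the two sides, since a component is closed under the remaining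
  edges, and every vertex is reached from one of the two ends. The last claim says that
  \<open>T\<close> can be rebuilt from the edge and the two sides.\<close>

lemma spanning_tree_split:
  assumes T: "T \<in> spanning_trees V" and e: "{a, b} \<in> T"
  defines "A \<equiv> edge_component T a b"
  shows "A \<subseteq> V" "a \<in> A" "b \<in> V - A"
    "{e \<in> T. e \<subseteq> A} \<in> spanning_trees A"
    "{e \<in> T. e \<subseteq> V - A} \<in> spanning_trees (V - A)"
    "insert {a, b} ({e \<in> T. e \<subseteq> A} \<union> {e \<in> T. e \<subseteq> V - A}) = T"
proof -
  let ?F = "T - {{a, b}}"
  have edges: "\<And>e. e \<in> T \<Longrightarrow> e \<subseteq> V \<and> card e = 2" and conn: "graph_connected V T"
    and br: "bridges_only T" using T by (auto simp: spanning_trees_iff)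
  have ab: "a \<noteq> b" using edges[OF e] by auto
  have V: "a \<in> V" "b \<in> V" using edges[OF e] by auto
  show a: "a \<in> A" by (simp add: A_def edge_component_def)
  show AV: "A \<subseteq> V"
  proof
    fix v assume "v \<in> A"
    then have "connected_in ?F a v" by (simp add: A_def edge_component_def)
    then show "v \<in> V" by (rule connected_in_closed[OF _ V(1)]) (use edges in blast)
  qed
  show b: "b \<in> V - A"
    using bridges_onlyD[OF br e ab] V by (simp add: A_def edge_component_def)
  have step: "y \<in> A" if "{x, y} \<in> ?F" "x \<in> A" for x y
    using that unfolding A_def edge_component_def
    by (auto intro: rtranclp.rtrancl_into_rtrancl)
  have step': "y \<in> A \<longleftrightarrow> x \<in> A" if "{x, y} \<in> ?F" for x y
    using step[of x y] step[of y x] that by (metis insert_commute)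
  \<comment> \<open>Whenever a walk from \<open>a\<close> uses the deleted edge it arrives at
    \<open>a\<close> or \<open>b\<close>, and can be restarted there.\<close>
  have either: "connected_in ?F a v \<or> connected_in ?F b v" if "v \<in> V" for v
  proof -
    have "connected_in T a v" using conn V that by (auto simp: graph_connected_def)
    then show ?thesis
    proof induction
      case (step y z)
      show ?case
      proof (cases "{y, z} = {a, b}")
        case True
        then have "z = a \<or> z = b" by (auto simp: doubleton_eq_iff)
        then show ?thesis by auto
      next
        case False
        then have "{y, z} \<in> ?F" using step by simp
        then show ?thesis using step.IH by (meson rtranclp.rtrancl_into_rtrancl)
      qed
    qed auto
  qed
  have fromb: "connected_in ?F b v" if "v \<in> V - A" for v
    using either[of v] that by (auto simp: A_def edge_component_def)
  have FA: "{e \<in> ?F. e \<subseteq> A} = {e \<in> T. e \<subseteq> A}" and FB: "{e \<in> ?F. e \<subseteq> V - A} = {e \<in> T. e \<subseteq> V - A}"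
    using a b by auto

  have "graph_connected A {e \<in> T. e \<subseteq> A}"
  proof (rule graph_connected_from_hub[of _ _ a])
    fix v assume "v \<in> A"
    then have "connected_in ?F a v" by (simp add: A_def edge_component_def)
    then have "connected_in {e \<in> ?F. e \<subseteq> A} a v"
      by (rule connected_in_restrict[OF _ a]) (fact step)
    then show "connected_in {e \<in> T. e \<subseteq> A} a v" by (simp only: FA)
  qed
  then show "{e \<in> T. e \<subseteq> A} \<in> spanning_trees A"
    using edges bridges_only_mono[OF br, of "{e \<in> T. e \<subseteq> A}"] by (auto simp: spanning_trees_iff)
  have "graph_connected (V - A) {e \<in> T. e \<subseteq> V - A}"
  proof (rule graph_connected_from_hub[of _ _ b])
    fix v assume v: "v \<in> V - A"
    have "connected_in {e \<in> ?F. e \<subseteq> V - A} b v"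
      by (rule connected_in_restrict[OF fromb[OF v] b]) (use step' edges in blast)
    then show "connected_in {e \<in> T. e \<subseteq> V - A} b v" by (simp only: FB)
  qed
  then show "{e \<in> T. e \<subseteq> V - A} \<in> spanning_trees (V - A)"
    using edges bridges_only_mono[OF br, of "{e \<in> T. e \<subseteq> V - A}"] by (auto simp: spanning_trees_iff)
  have "f \<subseteq> A \<or> f \<subseteq> V - A" if fT: "f \<in> T" and ne: "f \<noteq> {a, b}" for f
  proof -
    obtain x y where f: "f = {x, y}" using edges[OF fT] by (auto simp: card_2_iff)
    then show ?thesis using step'[of x y] fT ne edges[OF fT] by auto
  qed
  then show "insert {a, b} ({e \<in> T. e \<subseteq> A} \<union> {e \<in> T. e \<subseteq> V - A}) = T"
    using e by auto
qed

text \<open>Collapsing the side of the new edge that does not contain \<open>u\<close> and \<open>v\<close> maps a connection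
  in the joined graph to one inside \<open>T\<close>.\<close>

lemma connected_in_join_restrict:
  assumes T: "\<And>e. e \<in> T \<Longrightarrow> e \<subseteq> A" and U: "\<And>e. e \<in> U \<Longrightarrow> e \<subseteq> B" and disj: "A \<inter> B = {}"
    and ab: "a \<in> A" "b \<in> B" and uv: "u \<in> A" "v \<in> A"
    and c: "connected_in (insert {a, b} (T \<union> U)) u v"
  shows "connected_in T u v"
proof -
  define p where "p x = (if x \<in> A then x else a)" for x
  have "connected_in T (p u) (p v)"
    using c
  proof induction
    case (step y z)
    have "p y = p z \<or> {p y, p z} \<in> T"
    proof -
      consider "{y, z} = {a, b}" | "{y, z} \<in> T" | "{y, z} \<in> U" using step.hyps by blast
      then show ?thesis
      proof cases
        case 1
        then show ?thesis using ab disj by (auto simp: p_def doubleton_eq_iff)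
      next
        case 2
        then show ?thesis using T[OF 2] by (auto simp: p_def)
      next
        case 3
        then show ?thesis using U[OF 3] disj by (auto simp: p_def)
      qed
    qed
    then show ?case using step.IH by (metis (no_types, lifting) rtranclp.rtrancl_into_rtrancl)
  qed auto
  then show ?thesis using uv by (simp add: p_def)
qed

text \<open>Inverse of \<open>spanning_tree_split\<close>. The new edge is a bridge because nothing
  else crosses; an old edge stays one because a detour to the other side must return through the
  single new edge. The disjointness claims make edge products multiplicative and edge counts
  additive.\<close>

lemma spanning_tree_join:
  assumes T: "T \<in> spanning_trees A" and U: "U \<in> spanning_trees B" and disj: "A \<inter> B = {}"
    and a: "a \<in> A" and b: "b \<in> B"
  defines "J \<equiv> insert {a, b} (T \<union> U)"
  shows "J \<in> spanning_trees (A \<union> B)" "edge_component J a b = A"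
    "{e \<in> J. e \<subseteq> A} = T" "{e \<in> J. e \<subseteq> B} = U" "{a, b} \<notin> T" "{a, b} \<notin> U" "T \<inter> U = {}"
proof -
  have TA: "\<And>e. e \<in> T \<Longrightarrow> e \<subseteq> A \<and> card e = 2" and Tc: "graph_connected A T" and Tb: "bridges_only T"
    using T by (auto simp: spanning_trees_iff)
  have UB: "\<And>e. e \<in> U \<Longrightarrow> e \<subseteq> B \<and> card e = 2" and Uc: "graph_connected B U" and Ub: "bridges_only U"
    using U by (auto simp: spanning_trees_iff)
  have ab: "a \<noteq> b" "a \<notin> B" "b \<notin> A" using a b disj by auto
  show aT: "{a, b} \<notin> T" and aU: "{a, b} \<notin> U" using TA UB ab by blast+
  have UA: "\<not> e \<subseteq> A" if "e \<in> U" for e using UB[OF that] disj by (auto simp: card_2_iff)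
  have TB: "\<not> e \<subseteq> B" if "e \<in> T" for e using TA[OF that] disj by (auto simp: card_2_iff)
  show TU: "T \<inter> U = {}" using TA UA by blast
  show "{e \<in> J. e \<subseteq> A} = T" unfolding J_def using ab by (auto dest: TA UA)
  show "{e \<in> J. e \<subseteq> B} = U" unfolding J_def using ab by (auto dest: UB TB)
  have J0: "J - {{a, b}} = T \<union> U" using aT aU by (auto simp: J_def)
  show comp: "edge_component J a b = A"
  proof
    show "edge_component J a b \<subseteq> A"
    proof
      fix v assume "v \<in> edge_component J a b"
      then have "connected_in (T \<union> U) a v" by (simp add: edge_component_def J0)
      then show "v \<in> A" by (rule connected_in_closed[OF _ a]) (use TA UB disj in blast)
    qed
    show "A \<subseteq> edge_component J a b"
    proof
      fix v assume "v \<in> A"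
      then have "connected_in T a v" using Tc a by (auto simp: graph_connected_def)
      then have "connected_in (T \<union> U) a v" by (rule connected_in_mono) simp
      then show "v \<in> edge_component J a b" by (simp add: edge_component_def J0)
    qed
  qed
  have conn: "graph_connected (A \<union> B) J"
  proof -
    have "connected_in J a v" if "v \<in> A \<union> B" for v
    proof (cases "v \<in> A")
      case True
      then have "connected_in T a v" using Tc a by (auto simp: graph_connected_def)
      then show ?thesis by (rule connected_in_mono) (auto simp: J_def)
    next
      case False
      then have "connected_in U b v" using Uc b that by (auto simp: graph_connected_def)
      then have "connected_in J b v" by (rule connected_in_mono) (auto simp: J_def)
      moreover have "{a, b} \<in> J" by (simp add: J_def)
      ultimately show ?thesis by (meson converse_rtranclp_into_rtranclp)
    qed
    then show ?thesis by (rule graph_connected_from_hub)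
  qed
  have bJ: "bridges_only J"
    unfolding bridges_only_def
  proof (intro allI impI notI)
    fix u v assume uv: "{u, v} \<in> J" "u \<noteq> v" and c: "connected_in (J - {{u, v}}) u v"
    consider "{u, v} = {a, b}" | "{u, v} \<in> T" | "{u, v} \<in> U" using uv J_def by blast
    then show False
    proof cases
      case 1
      then have "connected_in (T \<union> U) u v" using c J0 by simp
      moreover have "u = a \<and> v = b \<or> u = b \<and> v = a" using 1 by (auto simp: doubleton_eq_iff)
      ultimately have "connected_in (T \<union> U) a b" using connected_in_sym[of "T \<union> U" b a] by auto
      then have "b \<in> edge_component J a b" by (simp add: edge_component_def J0)
      then show False using comp ab by simp
    next
      case 2
      have "connected_in (insert {a, b} ((T - {{u, v}}) \<union> U)) u v"
        by (rule connected_in_mono[OF c]) (auto simp: J_def)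
      then have "connected_in (T - {{u, v}}) u v"
        by (rule connected_in_join_restrict[where A = A and B = B, rotated -1])
          (use TA UB disj a b 2 in auto)
      then show False using bridges_onlyD[OF Tb 2 uv(2)] by simp
    next
      case 3
      have "connected_in (insert {b, a} ((U - {{u, v}}) \<union> T)) u v"
        by (rule connected_in_mono[OF c]) (auto simp: J_def)
      then have "connected_in (U - {{u, v}}) u v"
        by (rule connected_in_join_restrict[where A = B and B = A, rotated -1])
          (use TA UB disj a b 3 in auto)
      then show False using bridges_onlyD[OF Ub 3 uv(2)] by simp
    qed
  qed
  have "\<And>e. e \<in> J \<Longrightarrow> e \<subseteq> A \<union> B \<and> card e = 2"
    using TA UB a b ab unfolding J_def by (auto simp: card_2_iff)
  with conn bJ show "J \<in> spanning_trees (A \<union> B)" by (simp add: spanning_trees_iff)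
qed

lemma spanning_trees_singleton: "spanning_trees {v} = {{}}"
proof -
  have "T = {}" if "T \<in> spanning_trees {v}" for T
  proof -
    have "e = {}  \<or> e = {v}" "card e = 2" if "e \<in> T" for e
      using that \<open>T \<in> _\<close> by (auto simp: spanning_trees_iff)
    then show ?thesis by force
  qed
  moreover have "{} \<in> spanning_trees {v}"
    by (auto simp: spanning_trees_iff graph_connected_def bridges_only_def)
  ultimately show ?thesis by blast
qed

text \<open>Induction by cutting at any edge: the two sides each have one edge less than vertices,
  and the cut edge makes up for one of the two deficits. The empty vertex set is excluded because it
  has the empty graph as a spanning tree.\<close>

lemma card_spanning_tree:
  assumes "finite V" "T \<in> spanning_trees V" "V \<noteq> {}"
  shows "Suc (card T) = card V"
  using assms
proof (induction "card V" arbitrary: V T rule: less_induct)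
  case less
  have fT: "finite T"
    using less.prems spanning_trees_subset_Pow[of V] by (auto intro: finite_subset[of T "Pow V"])
  show ?case
  proof (cases "T = {}")
    case True
    have "x = y" if "x \<in> V" "y \<in> V" for x y
    proof -
      have "connected_in {} x y"
        using less.prems(2) that True by (auto simp: spanning_trees_iff graph_connected_def)
      then show ?thesis by cases auto
    qed
    then obtain v where "V = {v}" using less.prems by blast
    then show ?thesis using True by simp
  next
    case False
    then obtain e where e: "e \<in> T" by blast
    then have "card e = 2" using less.prems(2) by (auto simp: spanning_trees_iff)
    then obtain a b where ab: "{a, b} \<in> T" using e by (auto simp: card_2_iff)
    define A where "A = edge_component T a b"
    note split = spanning_tree_split[OF less.prems(2) ab, folded A_def]
    note join = spanning_tree_join[OF split(4,5) _ split(2,3)]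
    have fA: "finite A" "finite (V - A)" using less.prems(1) finite_subset[OF split(1)] by auto
    have "A \<subset> V" "V - A \<subset> V" using split(1-3) by auto
    then have cards: "card A < card V" "card (V - A) < card V"
      using less.prems(1) by (auto intro: psubset_card_mono)
    have c1: "Suc (card {e \<in> T. e \<subseteq> A}) = card A"
      by (rule less.hyps[OF cards(1) fA(1) split(4)]) (use split in auto)
    have c2: "Suc (card {e \<in> T. e \<subseteq> V - A}) = card (V - A)"
      by (rule less.hyps[OF cards(2) fA(2) split(5)]) (use split in auto)
    have "card T = card (insert {a, b} ({e \<in> T. e \<subseteq> A} \<union> {e \<in> T. e \<subseteq> V - A}))"
      by (simp only: split(6))
    also have "\<dots> = Suc (card ({e \<in> T. e \<subseteq> A} \<union> {e \<in> T. e \<subseteq> V - A}))"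
      using fT join(5,6) by (subst card_insert_disjoint) auto
    also have "\<dots> = Suc (card {e \<in> T. e \<subseteq> A} + card {e \<in> T. e \<subseteq> V - A})"
      using fT join(7) by (subst card_Un_disjoint) auto
    finally show ?thesis using c1 c2 card_Diff_subset[OF fA(1) split(1)] card_mono[OF less.prems(1) split(1)]
      by simp
  qed
qed

section \<open>Weighted sums over spanning trees\<close>

definition tree_sum :: "('a set \<Rightarrow> real) \<Rightarrow> 'a set \<Rightarrow> real" where
  "tree_sum w V = (\<Sum>T\<in>spanning_trees V. \<Prod>e\<in>T. w e)"

lemma finite_spanning_tree: "finite V \<Longrightarrow> T \<in> spanning_trees V \<Longrightarrow> finite T"
  using spanning_trees_subset_Pow[of V] by (auto intro: finite_subset[of T "Pow V"])

lemma tree_sum_singleton: "tree_sum w {v} = 1"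
  by (simp add: tree_sum_def spanning_trees_singleton)

text \<open>The map from ordered pairs to edges is two to one. This is the 2 that cancels the 1/2 in
  the gain term.\<close>

lemma card_oriented_edges:
  assumes "finite T" "\<And>e. e \<in> T \<Longrightarrow> card e = 2"
  shows "card {(a, b). {a, b} \<in> T} = 2 * card T"
proof -
  have eq: "{(a, b). {a, b} \<in> T} = (\<Union>e\<in>T. {(a, b). {a, b} = e})" by auto
  have c: "finite {(a, b). {a, b} = e} \<and> card {(a, b). {a, b} = e} = 2" if e: "e \<in> T" for e
  proof -
    obtain u v where uv: "e = {u, v}" "u \<noteq> v" using assms(2)[OF e] by (auto simp: card_2_iff)
    then have "{(a, b). {a, b} = e} = {(u, v), (v, u)}" by (auto simp: doubleton_eq_iff)
    then show ?thesis using uv by simp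
  qed
  have "card {(a, b). {a, b} \<in> T} = (\<Sum>e\<in>T. card {(a, b). {a, b} = e})"
    unfolding eq by (rule card_UN_disjoint) (use assms c in auto)
  then show ?thesis using c by simp
qed

lemma finite_oriented_edges:
  assumes "finite V" "T \<in> spanning_trees V" shows "finite {(a, b). {a, b} \<in> T}"
proof (rule finite_subset)
  show "{(a, b). {a, b} \<in> T} \<subseteq> V \<times> V" using assms(2) by (auto simp: spanning_trees_iff)
qed (use assms in simp)

text \<open>A tree with a marked oriented edge is the same as an ordered pair of rooted trees on a
  partition of the vertex set.\<close>

theorem tree_sum_edge_removal:
  assumes V: "finite V" "V \<noteq> {}"
  shows "2 * (real (card V) - 1) * tree_sum w V =
    (\<Sum>A\<in>Pow V. \<Sum>(a, b)\<in>A \<times> (V - A). w {a, b} * tree_sum w A * tree_sum w (V - A))"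
proof -
  define wt where "wt T = (\<Prod>e\<in>T. w e)" for T
  define OE where "OE T = {(a, b). {a, b} \<in> T}" for T :: "'a set set"
  \<comment> \<open>\<open>P\<close> consists of trees with a marked oriented edge. \<open>Q\<close>
    consists of the side \<open>A\<close> of its first endpoint, the edge itself, and a tree on each
    side; \<open>G\<close> is the weight after gluing. The choices \<open>A = {}\<close> and
    \<open>A = V\<close> admit no crossing edge and contribute nothing.\<close>
  define P where "P = Sigma (spanning_trees V) OE"
  define Q where "Q = Sigma (Pow V) (\<lambda>A. (A \<times> (V - A)) \<times> (spanning_trees A \<times> spanning_trees (V - A)))"
  define G where "G A p q = w {fst p, snd p} * (wt (fst q) * wt (snd q))"
    for A :: "'a set" and p :: "'a \<times> 'a" and q
  have fT: "finite T" if "T \<in> spanning_trees V" for T using finite_spanning_tree V that by blast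
  have "2 * (real (card V) - 1) * tree_sum w V = (\<Sum>T\<in>spanning_trees V. real (card (OE T)) * wt T)"
    unfolding tree_sum_def sum_distrib_left
  proof (rule sum.cong[OF refl])
    fix T assume T: "T \<in> spanning_trees V"
    have "card (OE T) = 2 * card T"
      unfolding OE_def using T by (intro card_oriented_edges fT) (auto simp: spanning_trees_iff)
    moreover have "real (card V) - 1 = real (card T)"
      using card_spanning_tree[OF V(1) T V(2)] by linarith
    ultimately show "2 * (real (card V) - 1) * (\<Prod>e\<in>T. w e) = real (card (OE T)) * wt T"
      by (simp add: wt_def)
  qed
  also have "\<dots> = (\<Sum>T\<in>spanning_trees V. \<Sum>p\<in>OE T. wt T)" by simp
  also have "\<dots> = (\<Sum>(T, p)\<in>P. wt T)"
    unfolding P_def using V finite_oriented_edges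
    by (intro sum.Sigma) (auto simp: finite_spanning_trees OE_def)
  also have "\<dots> = (\<Sum>(A, p, q)\<in>Q. G A p q)"
  proof (rule sum.reindex_bij_witness[where
      j = "\<lambda>(T, p). (edge_component T (fst p) (snd p), p,
             {e \<in> T. e \<subseteq> edge_component T (fst p) (snd p)}, {e \<in> T. e \<subseteq> V - edge_component T (fst p) (snd p)})"
      and i = "\<lambda>(A, p, q). (insert {fst p, snd p} (fst q \<union> snd q), p)"])
    fix z assume "z \<in> P"
    then obtain T a b where z: "z = (T, (a, b))" and T: "T \<in> spanning_trees V" and e: "{a, b} \<in> T"
      by (auto simp: P_def OE_def)
    note split = spanning_tree_split[OF T e]
    have VA: "edge_component T a b \<inter> (V - edge_component T a b) = {}" by auto
    note join = spanning_tree_join[OF split(4,5) VA split(2,3)]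
    show "(case case z of (T, p) \<Rightarrow> (edge_component T (fst p) (snd p), p,
             {e \<in> T. e \<subseteq> edge_component T (fst p) (snd p)}, {e \<in> T. e \<subseteq> V - edge_component T (fst p) (snd p)}) of
        (A, p, q) \<Rightarrow> (insert {fst p, snd p} (fst q \<union> snd q), p)) = z"
      using split(6) by (simp add: z)
    show "(case z of (T, p) \<Rightarrow> (edge_component T (fst p) (snd p), p,
             {e \<in> T. e \<subseteq> edge_component T (fst p) (snd p)}, {e \<in> T. e \<subseteq> V - edge_component T (fst p) (snd p)})) \<in> Q"
      using split by (simp add: z Q_def)
    have "wt T = wt (insert {a, b} ({e \<in> T. e \<subseteq> edge_component T a b} \<union> {e \<in> T. e \<subseteq> V - edge_component T a b}))"
      by (simp only: split(6))
    also have "\<dots> = w {a, b} * (wt {e \<in> T. e \<subseteq> edge_component T a b} * wt {e \<in> T. e \<subseteq> V - edge_component T a b})"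
      unfolding wt_def using join(5-7) fT[OF T]
      by (subst prod.insert) (auto simp: prod.union_disjoint)
    finally show "(case case z of (T, p) \<Rightarrow> (edge_component T (fst p) (snd p), p,
             {e \<in> T. e \<subseteq> edge_component T (fst p) (snd p)}, {e \<in> T. e \<subseteq> V - edge_component T (fst p) (snd p)}) of
        (A, p, q) \<Rightarrow> G A p q) = (case z of (T, p) \<Rightarrow> wt T)"
      by (simp add: z G_def)
  next
    fix z assume "z \<in> Q"
    then obtain A a b T U where z: "z = (A, (a, b), (T, U))" and A: "A \<subseteq> V" and ab: "a \<in> A" "b \<in> V - A"
      and TU: "T \<in> spanning_trees A" "U \<in> spanning_trees (V - A)"
      by (auto simp: Q_def)
    have VA: "A \<inter> (V - A) = {}" "A \<union> (V - A) = V" using A by auto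
    note join = spanning_tree_join[OF TU VA(1) ab]
    show "(case case z of (A, p, q) \<Rightarrow> (insert {fst p, snd p} (fst q \<union> snd q), p) of
        (T, p) \<Rightarrow> (edge_component T (fst p) (snd p), p,
             {e \<in> T. e \<subseteq> edge_component T (fst p) (snd p)}, {e \<in> T. e \<subseteq> V - edge_component T (fst p) (snd p)})) = z"
      by (simp add: z join(2) join(3,4)[simplified])
    show "(case z of (A, p, q) \<Rightarrow> (insert {fst p, snd p} (fst q \<union> snd q), p)) \<in> P"
      using join(1) VA by (simp add: z P_def OE_def)
  qed
  also have "\<dots> = (\<Sum>A\<in>Pow V. \<Sum>(p, q)\<in>(A \<times> (V - A)) \<times> (spanning_trees A \<times> spanning_trees (V - A)). G A p q)"
    unfolding Q_def using V
    by (subst sum.Sigma) (auto intro!: finite_cartesian_product finite_spanning_trees intro: finite_subset)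
  also have "\<dots> = (\<Sum>A\<in>Pow V. \<Sum>(a, b)\<in>A \<times> (V - A). w {a, b} * tree_sum w A * tree_sum w (V - A))"
  proof (rule sum.cong[OF refl])
    fix A assume "A \<in> Pow V"
    have prd: "tree_sum w A * tree_sum w (V - A) =
        (\<Sum>q\<in>spanning_trees A \<times> spanning_trees (V - A). wt (fst q) * wt (snd q))"
      unfolding tree_sum_def sum_product sum.cartesian_product by (simp add: wt_def case_prod_unfold)
    have "(\<Sum>(p, q)\<in>(A \<times> (V - A)) \<times> (spanning_trees A \<times> spanning_trees (V - A)). G A p q) =
       (\<Sum>p\<in>A \<times> (V - A). \<Sum>q\<in>spanning_trees A \<times> spanning_trees (V - A). G A p q)"
      by (rule sum.cartesian_product[symmetric])
    also have "\<dots> = (\<Sum>p\<in>A \<times> (V - A). w {fst p, snd p} * (tree_sum w A * tree_sum w (V - A)))"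
      unfolding G_def prd sum_distrib_left ..
    finally show "(\<Sum>(p, q)\<in>(A \<times> (V - A)) \<times> (spanning_trees A \<times> spanning_trees (V - A)). G A p q) =
       (\<Sum>(a, b)\<in>A \<times> (V - A). w {a, b} * tree_sum w A * tree_sum w (V - A))"
      by (simp add: case_prod_unfold mult.assoc)
  qed
  finally show ?thesis .
qed

section \<open>Relabelling the vertices of a tree\<close>

lemma connected_in_map:
  assumes "connected_in E x y" "\<And>x y. {x, y} \<in> E \<Longrightarrow> {f x, f y} \<in> F"
  shows "connected_in F (f x) (f y)"
  using assms(1) by induction (auto intro: rtranclp.rtrancl_into_rtrancl assms(2))

text \<open>Walks are pushed forward by \<open>h\<close>. For bridges they are pulled back by
  \<open>inv_into A h\<close>, which recovers each edge from its image and so respects the deletion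
  of an edge.\<close>

lemma spanning_trees_image:
  assumes inj: "inj_on h A" and T: "T \<in> spanning_trees A"
  shows "(`) h ` T \<in> spanning_trees (h ` A)"
proof -
  have TA: "\<And>e. e \<in> T \<Longrightarrow> e \<subseteq> A \<and> card e = 2" and Tc: "graph_connected A T" and Tb: "bridges_only T"
    using T by (auto simp: spanning_trees_iff)
  let ?g = "inv_into A h"
  have g: "?g (h x) = x" if "x \<in> A" for x using inj that by simp
  have conn: "graph_connected (h ` A) ((`) h ` T)"
    unfolding graph_connected_def
  proof (intro ballI)
    fix i j assume "i \<in> h ` A" "j \<in> h ` A"
    then obtain u v where uv: "u \<in> A" "v \<in> A" "i = h u" "j = h v" by auto
    then have "connected_in T u v" using Tc by (auto simp: graph_connected_def)
    then have "connected_in ((`) h ` T) (h u) (h v)"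
      by (rule connected_in_map) (auto intro: image_eqI[where x = "{_, _}"])
    then show "connected_in ((`) h ` T) i j" using uv by simp
  qed
  have br: "bridges_only ((`) h ` T)"
    unfolding bridges_only_def
  proof (intro allI impI notI)
    fix a b assume e: "{a, b} \<in> (`) h ` T" and ne: "a \<noteq> b"
      and c: "connected_in ((`) h ` T - {{a, b}}) a b"
    from e obtain e' where e': "e' \<in> T" "{a, b} = h ` e'" by auto
    have im: "?g ` h ` f = f" if "f \<in> T" for f using TA[OF that] g by (force simp: image_iff)
    have gab: "e' = {?g a, ?g b}" using im[OF e'(1)] e'(2)[symmetric] by simp
    have "connected_in (T - {{?g a, ?g b}}) (?g a) (?g b)"
    proof (rule connected_in_map[OF c])
      fix x y assume "{x, y} \<in> (`) h ` T - {{a, b}}"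
      then have "{x, y} \<in> (`) h ` T" "{x, y} \<noteq> h ` e'" using e' by simp_all
      then obtain f where f: "f \<in> T" "{x, y} = h ` f" "h ` f \<noteq> h ` e'" by (elim imageE) simp
      then have "f = {?g x, ?g y}" using im[OF f(1)] f(2)[symmetric] by simp
      moreover have "f \<noteq> e'" using f by auto
      ultimately show "{?g x, ?g y} \<in> T - {{?g a, ?g b}}" using f(1) gab by simp
    qed
    moreover have "?g a \<noteq> ?g b" using TA[OF e'(1)] gab by auto
    moreover have "{?g a, ?g b} \<in> T" using e'(1) gab by simp
    ultimately show False using bridges_onlyD[OF Tb] by blast
  qed
  have "card (h ` e) = 2" if "e \<in> T" for e
    using TA[OF that] inj_on_subset[OF inj, of e] by (simp add: card_image)
  with conn br TA show ?thesis by (auto simp: spanning_trees_iff)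
qed

lemma tree_sum_bij:
  assumes h: "bij_betw h A B" and w: "\<And>e. e \<subseteq> A \<Longrightarrow> card e = 2 \<Longrightarrow> w' (h ` e) = w e"
  shows "tree_sum w' B = tree_sum w A"
  unfolding tree_sum_def
proof (rule sum.reindex_bij_witness[symmetric, where j = "(`) ((`) h)" and i = "(`) ((`) (inv_into A h))"])
  have inj: "inj_on h A" and B: "B = h ` A" using h by (auto simp: bij_betw_def)
  have inj': "inj_on (inv_into A h) B" and A: "inv_into A h ` B = A"
    using bij_betw_inv_into[OF h] by (auto simp: bij_betw_def)
  fix T assume T: "T \<in> spanning_trees A"
  then have TA: "\<And>e. e \<in> T \<Longrightarrow> e \<subseteq> A \<and> card e = 2" by (auto simp: spanning_trees_iff)
  have "inv_into A h ` h ` e = e" if "e \<in> T" for e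
    using TA[OF that] inj by (force simp: image_iff)
  then show "(`) (inv_into A h) ` (`) h ` T = T" by (force simp: image_iff)
  show "(`) h ` T \<in> spanning_trees B" using spanning_trees_image[OF inj T] B by simp
  have "inj_on ((`) h) T" using inj_on_image_Pow[OF inj] by (rule inj_on_subset) (use TA in auto)
  then show "(\<Prod>e\<in>(`) h ` T. w' e) = (\<Prod>e\<in>T. w e)"
    using TA by (simp add: prod.reindex w)
next
  have inj: "inj_on h A" and B: "B = h ` A" using h by (auto simp: bij_betw_def)
  have inj': "inj_on (inv_into A h) B" and A: "inv_into A h ` B = A"
    using bij_betw_inv_into[OF h] by (auto simp: bij_betw_def)
  fix T assume T: "T \<in> spanning_trees B"
  then have TB: "\<And>e. e \<in> T \<Longrightarrow> e \<subseteq> B \<and> card e = 2" by (auto simp: spanning_trees_iff)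
  have "h ` inv_into A h ` e = e" if "e \<in> T" for e
    using image_inv_into_cancel[OF B[symmetric]] TB[OF that] by blast
  then show "(`) h ` (`) (inv_into A h) ` T = T" by (force simp: image_iff)
  show "(`) (inv_into A h) ` T \<in> spanning_trees A" using spanning_trees_image[OF inj' T] A by simp
qed

section \<open>Typed trees\<close>

abbreviation vsize :: "nat^'s::finite \<Rightarrow> nat" where
  "vsize k \<equiv> (\<Sum>s\<in>UNIV. k $ s)"

text \<open>Defined for every vertex set, since the two sides of a cut are arbitrary subsets and not
  initial intervals.\<close>

definition type_counts :: "('a \<Rightarrow> 's::finite) \<Rightarrow> 'a set \<Rightarrow> nat^'s" where
  "type_counts x A = (\<chi> r. card {i \<in> A. x i = r})"

definition edge_kernel :: "real^'s^'s \<Rightarrow> (nat \<Rightarrow> 's) \<Rightarrow> nat set \<Rightarrow> real" where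
  "edge_kernel \<kappa> x e = \<kappa> $ x (Min e) $ x (Max e)"

lemma edge_kernel_pair:
  assumes "transpose \<kappa> = \<kappa>"
  shows "edge_kernel \<kappa> x {a, b} = \<kappa> $ x a $ x b"
proof -
  have "\<kappa> $ x b $ x a = \<kappa> $ x a $ x b"
    using assms by (metis transpose_def vec_lambda_beta)
  then show ?thesis by (cases "a \<le> b") (auto simp: edge_kernel_def)
qed

lemma vsize_type_counts: "finite A \<Longrightarrow> vsize (type_counts x A) = card A"
proof -
  assume "finite A"
  then have "(\<Sum>r\<in>UNIV. \<Sum>i\<in>{i \<in> A. x i = r}. 1::nat) = (\<Sum>i\<in>A. 1)"
    by (intro sum.group) auto
  then show ?thesis by (simp add: type_counts_def)
qed

lemma has_type_counts_iff: "has_type_counts k x \<longleftrightarrow> type_counts x {1..vsize k} = k"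
  by (simp add: has_type_counts_def type_counts_def vec_eq_iff)

text \<open>Each type class has the same size in \<open>A\<close> and in \<open>B\<close>;
  bijections between the classes are glued.\<close>

lemma type_counts_bij:
  assumes fin: "finite A" "finite B" and eq: "type_counts x A = type_counts y B"
  obtains h where "bij_betw h A B" "\<And>i. i \<in> A \<Longrightarrow> y (h i) = x i"
proof -
  have "\<exists>g. bij_betw g {i \<in> A. x i = r} {j \<in> B. y j = r}" for r
    using fin eq by (intro finite_same_card_bij) (auto simp: type_counts_def vec_eq_iff)
  then obtain g where g: "\<And>r. bij_betw (g r) {i \<in> A. x i = r} {j \<in> B. y j = r}" by metis
  define h where "h i = g (x i) i" for i
  have h: "h i \<in> B" "y (h i) = x i" if "i \<in> A" for i
    using bij_betwE[OF g[of "x i"]] that by (auto simp: h_def)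
  have "bij_betw h A B"
    unfolding bij_betw_def
  proof
    show "inj_on h A"
    proof (rule inj_onI)
      fix i j assume ij: "i \<in> A" "j \<in> A" "h i = h j"
      then have xx: "x i = x j" using h by metis
      have "inj_on (g (x i)) {i' \<in> A. x i' = x i}" using g by (auto simp: bij_betw_def)
      then show "i = j" using ij xx by (auto simp: h_def inj_on_def)
    qed
    show "h ` A = B"
    proof
      show "B \<subseteq> h ` A"
      proof
        fix j assume "j \<in> B"
        then have "j \<in> g (y j) ` {i \<in> A. x i = y j}" using g[of "y j"] by (auto simp: bij_betw_def)
        then obtain i where "i \<in> A" "x i = y j" "j = g (y j) i" by auto
        then have "i \<in> A" "j = h i" by (simp_all add: h_def)
        then show "j \<in> h ` A" by blast
      qed
    qed (use h in auto)
  qed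
  then show ?thesis using h that by blast
qed

text \<open>Makes the choice of the type vector in \<open>tree_weight\<close> harmless, and lets a
  side of a cut tree be weighed by its type counts alone.\<close>

lemma tree_sum_type_counts:
  assumes "transpose \<kappa> = \<kappa>" "finite A" "finite B" "type_counts x A = type_counts y B"
  shows "tree_sum (edge_kernel \<kappa> y) B = tree_sum (edge_kernel \<kappa> x) A"
proof -
  obtain h where h: "bij_betw h A B" "\<And>i. i \<in> A \<Longrightarrow> y (h i) = x i"
    using type_counts_bij[OF assms(2-4)] by blast
  show ?thesis
  proof (rule tree_sum_bij[OF h(1)])
    fix e assume e: "e \<subseteq> A" "card e = 2"
    then obtain a b where "e = {a, b}" by (auto simp: card_2_iff)
    then show "edge_kernel \<kappa> y (h ` e) = edge_kernel \<kappa> x e"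
      using e h(2) by (simp add: edge_kernel_pair[OF assms(1)])
  qed
qed

text \<open>Enumerate the disjoint union of blocks of sizes \<open>k $ r\<close> and read off the
  block. This ensures that the choice in \<open>tree_weight\<close> has something to choose.\<close>

lemma ex_type_assignment: "\<exists>x::nat \<Rightarrow> 's::finite. type_counts x {1..vsize k} = k"
proof -
  let ?D = "SIGMA r:UNIV. {..<k $ r}"
  have "card ?D = vsize k" by simp
  then have "card {1..vsize k} = card ?D" by simp
  moreover have "finite ?D" by simp
  ultimately obtain h where h: "bij_betw h {1..vsize k} ?D"
    by (metis finite_atLeastAtMost finite_same_card_bij)
  have "card {i \<in> {1..vsize k}. fst (h i) = r} = k $ r" for r
  proof -
    have "bij_betw h {i \<in> {1..vsize k}. fst (h i) = r} {p \<in> ?D. fst p = r}"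
    proof -
      have "h ` {i \<in> {1..vsize k}. fst (h i) = r} = {p \<in> h ` {1..vsize k}. fst p = r}" by blast
      then show ?thesis using h unfolding bij_betw_def by (auto intro: inj_on_subset)
    qed
    then have "card {i \<in> {1..vsize k}. fst (h i) = r} = card {p \<in> ?D. fst p = r}"
      by (rule bij_betw_same_card)
    also have "{p \<in> ?D. fst p = r} = {r} \<times> {..<k $ r}" by auto
    finally show ?thesis by (simp add: card_cartesian_product)
  qed
  then have "type_counts (\<lambda>i. fst (h i)) {1..vsize k} = k"
    by (simp add: type_counts_def vec_eq_iff)
  then show ?thesis by blast
qed

lemma vsize_eq_0_iff [simp]: "vsize k = 0 \<longleftrightarrow> k = 0" for k :: "nat^'s::finite"
  by (simp add: vec_eq_iff)

text \<open>Every spanning tree has the same number of edges, so the powers of \<open>t\<close> come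
  out of the sum, and relabelling replaces the vertices \<open>1..|k|\<close> by those of
  \<open>A\<close>.\<close>

lemma tree_weight_eq:
  assumes \<kappa>: "transpose \<kappa> = \<kappa>" and A: "finite A" "A \<noteq> {}"
  shows "tree_weight \<kappa> t (type_counts x A) = t ^ (card A - 1) * tree_sum (edge_kernel \<kappa> x) A"
proof -
  let ?k = "type_counts x A"
  define y where "y = (SOME y. has_type_counts ?k y)"
  have vs: "vsize ?k = card A" using A by (simp add: vsize_type_counts)
  then have k0: "?k \<noteq> 0" using A vsize_eq_0_iff[of ?k] by auto
  have y: "type_counts y {1..vsize ?k} = ?k"
    using someI_ex[of "has_type_counts ?k"] ex_type_assignment[of ?k]
    unfolding has_type_counts_iff y_def by blast
  have card: "card T = card A - 1" if "T \<in> spanning_trees {1..vsize ?k}" for T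
  proof -
    have "1 \<le> card A" using A by (simp add: Suc_le_eq card_gt_0_iff)
    then have "Suc (card T) = card A" using card_spanning_tree[OF _ that] by (simp add: vs)
    then show ?thesis by simp
  qed
  have "tree_weight \<kappa> t ?k = (\<Sum>T\<in>spanning_trees {1..vsize ?k}. \<Prod>e\<in>T. t * edge_kernel \<kappa> y e)"
    using k0 by (simp add: tree_weight_def y_def edge_kernel_def Let_def)
  also have "\<dots> = t ^ (card A - 1) * tree_sum (edge_kernel \<kappa> y) {1..vsize ?k}"
    unfolding tree_sum_def sum_distrib_left
    by (rule sum.cong) (simp_all add: prod.distrib card)
  also have "tree_sum (edge_kernel \<kappa> y) {1..vsize ?k} = tree_sum (edge_kernel \<kappa> x) A"
    using A y by (intro tree_sum_type_counts[OF \<kappa>]) simp_all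
  finally show ?thesis .
qed

lemma tree_weight_nonneg: "(\<And>r s. \<kappa> $ r $ s \<ge> 0) \<Longrightarrow> t \<ge> 0 \<Longrightarrow> tree_weight \<kappa> t k \<ge> 0"
  unfolding tree_weight_def Let_def by (auto intro!: sum_nonneg prod_nonneg)

lemma tree_weight_scale:
  assumes "transpose \<kappa> = \<kappa>"
  shows "tree_weight \<kappa> t k = t ^ (vsize k - 1) * tree_weight \<kappa> 1 k"
proof (cases "k = 0")
  case False
  obtain x :: "nat \<Rightarrow> 'a" where x: "type_counts x {1..vsize k} = k" using ex_type_assignment by blast
  have ne: "{1..vsize k} \<noteq> {}" using False vsize_eq_0_iff[of k] by fastforce
  show ?thesis
    using tree_weight_eq[OF assms finite_atLeastAtMost ne, of t x]
      tree_weight_eq[OF assms finite_atLeastAtMost ne, of 1 x] x by simp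
qed (simp add: tree_weight_def)

lemma tree_weight_axis:
  assumes "transpose \<kappa> = \<kappa>"
  shows "tree_weight \<kappa> t (axis r 1) = 1"
proof -
  have "type_counts (\<lambda>_. r) {0::nat} = axis r 1"
    by (auto simp: type_counts_def axis_def vec_eq_iff)
  then show ?thesis
    using tree_weight_eq[OF assms, of "{0}" t "\<lambda>_. r"] by (simp add: tree_sum_singleton)
qed

section \<open>Splittings of a type vector and subsets with given type counts\<close>

lemma finite_vec_le: "finite {j::nat^'s::finite. \<forall>r. j $ r \<le> k $ r}"
proof -
  have "{j. \<forall>r. j $ r \<le> k $ r} \<subseteq> vec_lambda ` (UNIV \<rightarrow>\<^sub>E {..vsize k})"
  proof
    fix j assume "j \<in> {j. \<forall>r. j $ r \<le> k $ r}"
    then have "j $ r \<le> vsize k" for r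
      using member_le_sum[of r UNIV "\<lambda>s. k $ s"] by (auto intro: order_trans)
    then have "vec_nth j \<in> UNIV \<rightarrow>\<^sub>E {..vsize k}" by auto
    moreover have "j = vec_lambda (vec_nth j)" by simp
    ultimately show "j \<in> vec_lambda ` (UNIV \<rightarrow>\<^sub>E {..vsize k})" by blast
  qed
  then show ?thesis by (rule finite_subset) (intro finite_imageI finite_PiE, auto)
qed

lemma finite_splittings: "finite {(j, l). j + l = (k::nat^'s::finite)}"
proof (rule finite_subset)
  show "{(j, l). j + l = k} \<subseteq> {j. \<forall>r. j $ r \<le> k $ r} \<times> {j. \<forall>r. j $ r \<le> k $ r}" by auto
qed (intro finite_cartesian_product finite_vec_le)

text \<open>A subset amounts to an independent choice of its part in each type class.\<close>

lemma card_subsets_type_counts: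
  assumes "finite V"
  shows "card {A. A \<subseteq> V \<and> type_counts x A = j} = (\<Prod>r\<in>UNIV. (type_counts x V $ r) choose (j $ r))"
proof -
  let ?V = "\<lambda>r. {i \<in> V. x i = r}"
  have "bij_betw (\<lambda>A r. {i \<in> A. x i = r}) {A. A \<subseteq> V \<and> type_counts x A = j}
      (\<Pi>\<^sub>E r\<in>UNIV. {B. B \<subseteq> ?V r \<and> card B = j $ r})"
  proof (rule bij_betw_byWitness[where f' = "\<lambda>F. \<Union>r. F r"])
    show "(\<lambda>F. \<Union>r. F r) ` (\<Pi>\<^sub>E r\<in>UNIV. {B. B \<subseteq> ?V r \<and> card B = j $ r})
        \<subseteq> {A. A \<subseteq> V \<and> type_counts x A = j}"
    proof clarsimp
      fix F assume F: "F \<in> (\<Pi>\<^sub>E r\<in>UNIV. {B. B \<subseteq> ?V r \<and> card B = j $ r})"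
      then have F1: "F r \<subseteq> ?V r" "card (F r) = j $ r" for r by (auto simp: PiE_def Pi_def)
      then have "{i \<in> (\<Union>r. F r). x i = s} = F s" for s by auto
      with F1 show "(\<Union>r. F r) \<subseteq> V \<and> type_counts x (\<Union>r. F r) = j"
        by (auto simp: type_counts_def vec_eq_iff)
    qed
  next
    show "\<forall>F\<in>\<Pi>\<^sub>E r\<in>UNIV. {B. B \<subseteq> ?V r \<and> card B = j $ r}. (\<lambda>r. {i \<in> (\<Union>r. F r). x i = r}) = F"
      by (fastforce simp: PiE_def Pi_def fun_eq_iff)
  qed (auto simp: type_counts_def vec_eq_iff)
  then have "card {A. A \<subseteq> V \<and> type_counts x A = j} = card (\<Pi>\<^sub>E r\<in>UNIV. {B. B \<subseteq> ?V r \<and> card B = j $ r})"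
    by (rule bij_betw_same_card)
  also have "\<dots> = (\<Prod>r\<in>UNIV. card (?V r) choose (j $ r))"
    using assms by (simp add: card_PiE n_subsets)
  finally show ?thesis by (simp add: type_counts_def)
qed

lemma sum_by_type:
  assumes "finite A"
  shows "(\<Sum>a\<in>A. f (x a)) = (\<Sum>r\<in>UNIV. real (type_counts x A $ r) * f r)"
proof -
  have "(\<Sum>a\<in>A. f (x a)) = (\<Sum>r\<in>UNIV. \<Sum>a\<in>{a \<in> A. x a = r}. f (x a))"
    using assms by (intro sum.group[symmetric]) auto
  also have "\<dots> = (\<Sum>r\<in>UNIV. real (type_counts x A $ r) * f r)"
    by (intro sum.cong refl) (simp add: type_counts_def)
  finally show ?thesis .
qed

lemma sum_kernel_by_type:
  assumes "finite A" "finite B"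
  shows "(\<Sum>(a, b)\<in>A \<times> B. \<kappa> $ x a $ x b) = coag_kernel \<kappa> (type_counts x A) (type_counts x B)"
proof -
  have "(\<Sum>(a, b)\<in>A \<times> B. \<kappa> $ x a $ x b) = (\<Sum>a\<in>A. \<Sum>b\<in>B. \<kappa> $ x a $ x b)"
    by (simp add: sum.cartesian_product)
  also have "\<dots> = (\<Sum>a\<in>A. \<Sum>s\<in>UNIV. real (type_counts x B $ s) * \<kappa> $ x a $ s)"
    by (rule sum.cong[OF refl], rule sum_by_type[OF assms(2)])
  also have "\<dots> = (\<Sum>r\<in>UNIV. real (type_counts x A $ r) * (\<Sum>s\<in>UNIV. real (type_counts x B $ s) * \<kappa> $ r $ s))"
    by (rule sum_by_type[OF assms(1)])
  also have "\<dots> = coag_kernel \<kappa> (type_counts x A) (type_counts x B)"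
    unfolding coag_kernel_def by (simp add: sum_distrib_left mult_ac)
  finally show ?thesis .
qed

lemma type_counts_Diff:
  assumes "finite V" "A \<subseteq> V"
  shows "type_counts x A + type_counts x (V - A) = type_counts x V"
proof -
  have "card {i \<in> A. x i = r} + card {i \<in> V - A. x i = r} = card {i \<in> V. x i = r}" for r
    using assms by (subst card_Un_disjoint[symmetric]) (auto intro: finite_subset intro!: arg_cong[where f = card])
  then show ?thesis by (simp add: type_counts_def vec_eq_iff)
qed

lemma coag_kernel_zero [simp]: "coag_kernel \<kappa> 0 l = 0" "coag_kernel \<kappa> j 0 = 0"
  by (simp_all add: coag_kernel_def)

text \<open>In \<open>tree_sum_edge_removal\<close> the summand depends on \<open>A\<close>, after
  summing over the crossing edges, only through the type counts of the two sides. Grouping by these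
  counts gives the binomial factors.\<close>

theorem tree_weight_recursion:
  assumes \<kappa>: "transpose \<kappa> = \<kappa>" and k: "k \<noteq> 0"
  shows "2 * (real (vsize k) - 1) * tree_weight \<kappa> 1 k =
    (\<Sum>(j, l) | j + l = k. (\<Prod>r\<in>UNIV. real ((k $ r) choose (j $ r))) *
       (coag_kernel \<kappa> j l * tree_weight \<kappa> 1 j * tree_weight \<kappa> 1 l))"
proof -
  obtain x :: "nat \<Rightarrow> 'a" where x: "type_counts x {1..vsize k} = k" using ex_type_assignment by blast
  define V where "V = {1..vsize k}"
  have V: "finite V" "V \<noteq> {}" "card V = vsize k"
    using k vsize_eq_0_iff[of k] unfolding V_def by fastforce+
  have xV: "type_counts x V = k" using x by (simp add: V_def)
  let ?w = "edge_kernel \<kappa> x"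
  let ?c = "\<lambda>A. (type_counts x A, type_counts x (V - A))"
  define F where "F = (\<lambda>(j, l). coag_kernel \<kappa> j l * tree_weight \<kappa> 1 j * tree_weight \<kappa> 1 l)"
  have tw: "tree_weight \<kappa> 1 (type_counts x A) = tree_sum ?w A" if "finite A" "A \<noteq> {}" for A
    using tree_weight_eq[OF \<kappa> that, of 1 x] by simp
  have "2 * (real (vsize k) - 1) * tree_weight \<kappa> 1 k = 2 * (real (card V) - 1) * tree_sum ?w V"
    using tw[OF V(1,2)] xV V(3) by simp
  also have "\<dots> = (\<Sum>A\<in>Pow V. \<Sum>(a, b)\<in>A \<times> (V - A). ?w {a, b} * tree_sum ?w A * tree_sum ?w (V - A))"
    by (rule tree_sum_edge_removal[OF V(1,2)])
  also have "\<dots> = (\<Sum>A\<in>Pow V. F (?c A))"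
  proof (rule sum.cong[OF refl])
    fix A assume "A \<in> Pow V"
    then have fin: "finite A" "finite (V - A)" using V finite_subset by auto
    have "(\<Sum>(a, b)\<in>A \<times> (V - A). ?w {a, b} * tree_sum ?w A * tree_sum ?w (V - A)) =
       (\<Sum>(a, b)\<in>A \<times> (V - A). \<kappa> $ x a $ x b) * (tree_sum ?w A * tree_sum ?w (V - A))"
      unfolding sum_distrib_right by (simp add: edge_kernel_pair[OF \<kappa>] case_prod_unfold mult.assoc)
    also have "\<dots> = coag_kernel \<kappa> (type_counts x A) (type_counts x (V - A)) * (tree_sum ?w A * tree_sum ?w (V - A))"
      by (simp only: sum_kernel_by_type[OF fin])
    \<comment> \<open>On the empty set \<open>tree_sum\<close> is 1 whereas
      \<open>tree_weight\<close> at 0 is 0; the vanishing kernel hides the mismatch.\<close>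
    also have "\<dots> = F (?c A)"
    proof (cases "A = {} \<or> V - A = {}")
      case True
      have "type_counts x {} = 0" by (simp add: type_counts_def vec_eq_iff)
      with True have "type_counts x A = 0 \<or> type_counts x (V - A) = 0" by metis
      then show ?thesis by (auto simp: F_def)
    next
      case False
      then show ?thesis using tw[OF fin(1)] tw[OF fin(2)] by (simp add: F_def)
    qed
    finally show "(\<Sum>(a, b)\<in>A \<times> (V - A). ?w {a, b} * tree_sum ?w A * tree_sum ?w (V - A)) = F (?c A)" .
  qed
  also have "\<dots> = (\<Sum>p | fst p + snd p = k. \<Sum>A\<in>{A \<in> Pow V. ?c A = p}. F (?c A))"
    using finite_splittings[of k] V type_counts_Diff[OF V(1), of _ x] xV
    by (intro sum.group[symmetric]) (auto simp: case_prod_unfold)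
  also have "\<dots> = (\<Sum>p | fst p + snd p = k. (\<Prod>r\<in>UNIV. real ((k $ r) choose (fst p $ r))) * F p)"
  proof (rule sum.cong[OF refl])
    fix p :: "(nat^'a) \<times> (nat^'a)" assume p: "p \<in> {p. fst p + snd p = k}"
    have "{A \<in> Pow V. ?c A = p} = {A. A \<subseteq> V \<and> type_counts x A = fst p}"
    proof -
      have "type_counts x (V - A) = snd p" if "A \<subseteq> V" "type_counts x A = fst p" for A
      proof -
        have "fst p + type_counts x (V - A) = fst p + snd p"
          using type_counts_Diff[OF V(1) that(1), of x] that(2) p xV by simp
        then show ?thesis by (rule add_left_imp_eq)
      qed
      then show ?thesis by (auto simp: prod_eq_iff)
    qed
    then have "card {A \<in> Pow V. ?c A = p} = (\<Prod>r\<in>UNIV. (k $ r) choose (fst p $ r))"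
      using card_subsets_type_counts[OF V(1), of x "fst p"] xV by simp
    moreover have "(\<Sum>A\<in>{A \<in> Pow V. ?c A = p}. F (?c A)) = real (card {A \<in> Pow V. ?c A = p}) * F p"
      by (subst sum_constant[symmetric]) (intro sum.cong, auto)
    ultimately show "(\<Sum>A\<in>{A \<in> Pow V. ?c A = p}. F (?c A)) =
        (\<Prod>r\<in>UNIV. real ((k $ r) choose (fst p $ r))) * F p" by simp
  qed
  finally show ?thesis by (simp add: F_def case_prod_unfold)
qed

text \<open>Coefficients of the multivariate exponential generating function of weighted trees: the
  factorials turn the binomial convolution into a plain one.\<close>

definition tree_coeff :: "real^'s^'s::finite \<Rightarrow> nat^'s \<Rightarrow> real" where
  "tree_coeff \<kappa> k = tree_weight \<kappa> 1 k / (\<Prod>r\<in>UNIV. fact (k $ r))"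

lemma tree_coeff_nonneg: "(\<And>r s. \<kappa> $ r $ s \<ge> 0) \<Longrightarrow> tree_coeff \<kappa> k \<ge> 0"
  unfolding tree_coeff_def by (intro divide_nonneg_nonneg tree_weight_nonneg prod_nonneg) auto

text \<open>The subtraction is truncated, so \<open>k = 0\<close> is included, with both sides
  zero.\<close>

lemma tree_coeff_recursion:
  assumes \<kappa>: "transpose \<kappa> = \<kappa>"
  shows "2 * real (vsize k - 1) * tree_coeff \<kappa> k =
    (\<Sum>(j, l) | j + l = k. coag_kernel \<kappa> j l * tree_coeff \<kappa> j * tree_coeff \<kappa> l)"
proof (cases "k = 0")
  case True
  have "(\<Sum>(j, l) | j + l = k. coag_kernel \<kappa> j l * tree_coeff \<kappa> j * tree_coeff \<kappa> l) = 0"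
    unfolding True by (intro sum.neutral) (auto simp: vec_eq_iff coag_kernel_def)
  then show ?thesis by (simp add: True)
next
  case False
  define P where "P k = (\<Prod>r\<in>UNIV. fact (k $ r) :: real)" for k :: "nat^'a"
  have P: "P k \<noteq> 0" for k by (simp add: P_def)
  have "vsize k \<ge> 1" using False vsize_eq_0_iff[of k] by linarith
  then have "2 * real (vsize k - 1) * tree_coeff \<kappa> k = (2 * (real (vsize k) - 1) * tree_weight \<kappa> 1 k) / P k"
    by (simp add: tree_coeff_def P_def of_nat_diff)
  also have "\<dots> = (\<Sum>(j, l) | j + l = k. coag_kernel \<kappa> j l * tree_coeff \<kappa> j * tree_coeff \<kappa> l)"
    unfolding tree_weight_recursion[OF \<kappa> False] sum_divide_distrib
  proof (rule sum.cong[OF refl], clarify)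
    fix j l assume "k = j + l"
    have "(\<Prod>r\<in>UNIV. real (((j + l) $ r) choose (j $ r))) = P (j + l) / (P j * P l)"
      unfolding P_def prod.distrib[symmetric] prod_dividef[symmetric]
      by (intro prod.cong refl) (simp add: binomial_fact)
    then show "(\<Prod>r\<in>UNIV. real (((j + l) $ r) choose (j $ r))) *
       (coag_kernel \<kappa> j l * tree_weight \<kappa> 1 j * tree_weight \<kappa> 1 l) / P (j + l) =
       coag_kernel \<kappa> j l * tree_coeff \<kappa> j * tree_coeff \<kappa> l"
      using P by (simp add: tree_coeff_def P_def[symmetric])
  qed
  finally show ?thesis .
qed

section \<open>The dual vector\<close>

text \<open>A maximiser of the norm on the unit sphere may be replaced by its absolute value
  \<open>f\<close>. It need not be an eigenvector of \<open>B\<close>, since the negative of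
  \<sigma> can be an eigenvalue too, but it is one of the square of \<open>B\<close>; adding
  \<open>B *v f\<close> and \<open>\<sigma> *\<^sub>R f\<close> repairs this without losing
  nonnegativity.\<close>

lemma Perron_eigenvector_above:
  fixes B :: "real^'s^'s::finite"
  assumes sym: "transpose B = B" and nn: "\<And>r s. B $ r $ s \<ge> 0" and v: "norm (B *v v) > norm v"
  obtains h \<sigma> where "\<sigma> > 1" "\<And>r. h $ r \<ge> 0" "h \<noteq> 0" "B *v h = \<sigma> *\<^sub>R h"
proof -
  have adj: "(B *v x) \<bullet> y = x \<bullet> (B *v y)" for x y
    using dot_lmul_matrix[of x B y] transpose_matrix_vector[of B x] by (simp add: sym)
  have "v \<noteq> 0" using v by auto
  have "sphere (0::real^'s) 1 \<noteq> {}" by simp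
  moreover have "continuous_on (sphere 0 1) (\<lambda>u. norm (B *v u))"
    by (intro continuous_intros linear_continuous_on matrix_vector_mul_bounded_linear)
  ultimately obtain u where u: "u \<in> sphere 0 1" and max: "\<And>y. y \<in> sphere 0 1 \<Longrightarrow> norm (B *v y) \<le> norm (B *v u)"
    using continuous_attains_sup[OF compact_sphere] by metis
  define f where "f = (\<chi> r. \<bar>u $ r\<bar>)"
  have "norm f = norm u" by (simp add: f_def norm_vec_def)
  then have f: "norm f = 1" using u by simp
  define \<sigma> where "\<sigma> = norm (B *v f)"
  have "\<bar>(B *v u) $ r\<bar> \<le> (B *v f) $ r" for r
    unfolding matrix_vector_mult_def f_def
    using sum_abs[of "\<lambda>j. B $ r $ j * u $ j" UNIV] by (simp add: abs_mult nn)
  then have "norm (B *v u) \<le> \<sigma>" unfolding \<sigma>_def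
    by (intro norm_le_componentwise_cart) (metis abs_ge_self order_trans real_norm_def)
  then have bound: "norm (B *v y) \<le> \<sigma> * norm y" for y
  proof (cases "y = 0")
    case False
    then have "norm (B *v ((1 / norm y) *\<^sub>R y)) \<le> norm (B *v u)" by (intro max) simp
    then show ?thesis using False \<open>norm (B *v u) \<le> \<sigma>\<close>
      by (simp add: matrix_vector_mult_scaleR divide_le_eq) (meson mult_right_mono norm_ge_zero order_trans)
  qed simp
  have "\<sigma> > 1"
  proof (rule ccontr)
    assume "\<not> \<sigma> > 1"
    then have "\<sigma> * norm v \<le> 1 * norm v" by (intro mult_right_mono) auto
    then show False using bound[of v] v by simp
  qed
  define g where "g = B *v (B *v f)"
  \<comment> \<open>Equality case of Cauchy-Schwarz: by symmetry \<open>g \<bullet> f\<close> is the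
    squared norm of \<open>B *v f\<close>, and \<open>norm g\<close> is at most
    \<open>\<sigma>\<^sup>2\<close>, so the three terms add up to at most 0.\<close>
  have "(norm (g - \<sigma>\<^sup>2 *\<^sub>R f))\<^sup>2 = (norm g)\<^sup>2 - 2 * \<sigma>\<^sup>2 * (g \<bullet> f) + \<sigma>^4 * (norm f)\<^sup>2"
    unfolding power2_norm_eq_inner by (simp add: inner_diff_left inner_diff_right inner_commute algebra_simps power2_eq_square power4_eq_xxxx)
  also have "g \<bullet> f = \<sigma>\<^sup>2" unfolding g_def adj \<sigma>_def power2_norm_eq_inner ..
  also have "(norm g)\<^sup>2 \<le> (\<sigma> * \<sigma>)\<^sup>2"
    using bound[of "B *v f"] by (intro power_mono) (simp_all add: g_def \<sigma>_def[symmetric])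
  finally have "(norm (g - \<sigma>\<^sup>2 *\<^sub>R f))\<^sup>2 \<le> 0"
    by (simp add: f power2_eq_square power4_eq_xxxx)
  then have g: "B *v (B *v f) = \<sigma>\<^sup>2 *\<^sub>R f" by (simp add: g_def)
  \<comment> \<open>From the factorisation of \<open>B\<^sup>2 - \<sigma>\<^sup>2\<close> into
    \<open>(B - \<sigma>) (B + \<sigma>)\<close>.\<close>
  define h where "h = B *v f + \<sigma> *\<^sub>R f"
  show thesis
  proof
    show "\<sigma> > 1" by fact
    have Bf: "(B *v f) $ r \<ge> 0" for r
      unfolding matrix_vector_mult_def f_def by (auto intro!: sum_nonneg simp: nn)
    then show h0: "h $ r \<ge> 0" for r using \<open>\<sigma> > 1\<close> by (simp add: h_def f_def)
    show "h \<noteq> 0"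
    proof
      assume "h = 0"
      then have "(B *v f) $ r + \<sigma> * f $ r = 0" for r by (simp add: h_def vec_eq_iff)
      moreover have "\<sigma> * f $ r \<ge> 0" for r using \<open>\<sigma> > 1\<close> by (simp add: f_def)
      ultimately have "\<sigma> * f $ r = 0" for r using Bf[of r] by (smt (verit))
      then have "f = 0" using \<open>\<sigma> > 1\<close> by (simp add: vec_eq_iff)
      then show False using f by simp
    qed
    show "B *v h = \<sigma> *\<^sub>R h"
      by (simp add: h_def matrix_vector_right_distrib matrix_vector_mult_scaleR g scaleR_add_right power2_eq_square)
  qed
qed

text \<open>Multiplication by the square root of \<mu> is an isometry from
  \<open>L\<^sup>2(\<mu>)\<close> onto Euclidean space and turns the operator into the symmetric
  nonnegative matrix \<open>B\<close>. Its eigenvector is then transported back.\<close>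

lemma Sigma_norm_gt_1_eigenfunction:
  fixes \<kappa> :: "real^'s^'s::finite"
  assumes sym: "transpose \<kappa> = \<kappa>" and nn: "\<And>r s. \<kappa> $ r $ s \<ge> 0" and \<mu>: "\<And>r. \<mu> $ r > 0"
    and gt: "Sigma_norm \<kappa> \<mu> > 1"
  obtains f \<sigma> where "\<sigma> > 1" "\<And>r. f r \<ge> 0" "\<exists>r. f r \<noteq> 0"
    "\<And>r. (\<Sum>s\<in>UNIV. \<kappa> $ r $ s * \<mu> $ s * f s) = \<sigma> * f r"
proof -
  \<comment> \<open>If no quotient exceeded 1, neither would the supremum. Division by zero gives 0,
    so this \<open>f\<close> has nonzero norm.\<close>
  obtain f where f: "1 < l2_norm_wrt \<mu> (kernel_operator \<kappa> \<mu> f) / l2_norm_wrt \<mu> f"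
    using gt unfolding Sigma_norm_def by (elim less_cSupE) auto
  have nn2: "l2_norm_wrt \<mu> f \<ge> 0" by (simp add: l2_norm_wrt_def \<mu> less_imp_le sum_nonneg)
  have "l2_norm_wrt \<mu> f \<noteq> 0" using f by auto
  with nn2 f have lt: "l2_norm_wrt \<mu> f < l2_norm_wrt \<mu> (kernel_operator \<kappa> \<mu> f)"
    by (simp add: less_divide_eq)
  define B where "B = (\<chi> r s. sqrt (\<mu> $ r) * \<kappa> $ r $ s * sqrt (\<mu> $ s))"
  have sq: "sqrt (\<mu> $ r) * sqrt (\<mu> $ r) = \<mu> $ r" "sqrt (\<mu> $ r) > 0" for r
    using \<mu>[of r] by auto
  have norm: "l2_norm_wrt \<mu> g = norm (\<chi> s. g $ s * sqrt (\<mu> $ s))" for g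
    using \<mu> by (simp add: l2_norm_wrt_def norm_vec_def L2_set_def power_mult_distrib less_imp_le)
  have "(\<chi> s. kernel_operator \<kappa> \<mu> f $ s * sqrt (\<mu> $ s)) = B *v (\<chi> s. f $ s * sqrt (\<mu> $ s))"
    unfolding vec_eq_iff
  proof
    fix r
    have key: "\<kappa> $ r $ s * f $ s * \<mu> $ s * sqrt (\<mu> $ r) =
        sqrt (\<mu> $ r) * \<kappa> $ r $ s * sqrt (\<mu> $ s) * (f $ s * sqrt (\<mu> $ s))" for s
    proof -
      have "\<kappa> $ r $ s * f $ s * (sqrt (\<mu> $ s) * sqrt (\<mu> $ s)) * sqrt (\<mu> $ r) =
        sqrt (\<mu> $ r) * \<kappa> $ r $ s * sqrt (\<mu> $ s) * (f $ s * sqrt (\<mu> $ s))"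
        by (simp only: mult_ac)
      then show ?thesis by (simp only: sq)
    qed
    show "(\<chi> s. kernel_operator \<kappa> \<mu> f $ s * sqrt (\<mu> $ s)) $ r = (B *v (\<chi> s. f $ s * sqrt (\<mu> $ s))) $ r"
      unfolding kernel_operator_def B_def matrix_vector_mult_def vec_lambda_beta sum_distrib_right key ..
  qed
  then have "norm (B *v (\<chi> s. f $ s * sqrt (\<mu> $ s))) > norm (\<chi> s. f $ s * sqrt (\<mu> $ s))"
    using lt norm by simp
  moreover have "\<kappa> $ r $ s = \<kappa> $ s $ r" for r s using sym by (metis transpose_def vec_lambda_beta)
  then have "transpose B = B" by (simp add: transpose_def B_def vec_eq_iff mult_ac)
  moreover have "B $ r $ s \<ge> 0" for r s by (simp add: B_def nn \<mu> less_imp_le)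
  ultimately obtain h \<sigma> where h: "\<sigma> > 1" "\<And>r. h $ r \<ge> 0" "h \<noteq> 0" "B *v h = \<sigma> *\<^sub>R h"
    using Perron_eigenvector_above by metis
  show thesis
  proof
    show "\<sigma> > 1" by fact
    show "h $ r / sqrt (\<mu> $ r) \<ge> 0" for r using h(2) sq(2)[of r] by simp
    show "\<exists>r. h $ r / sqrt (\<mu> $ r) \<noteq> 0" using h(3) sq(2) by (auto simp: vec_eq_iff) (metis less_irrefl)
    fix r
    have "sqrt (\<mu> $ r) * (\<Sum>s\<in>UNIV. \<kappa> $ r $ s * \<mu> $ s * (h $ s / sqrt (\<mu> $ s))) = (B *v h) $ r"
      unfolding sum_distrib_left matrix_vector_mult_def B_def vec_lambda_beta
    proof (rule sum.cong[OF refl])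
      fix s
      have "\<mu> $ s / sqrt (\<mu> $ s) = sqrt (\<mu> $ s)" using \<mu>[of s] by (simp add: real_div_sqrt)
      then show "sqrt (\<mu> $ r) * (\<kappa> $ r $ s * \<mu> $ s * (h $ s / sqrt (\<mu> $ s))) =
          sqrt (\<mu> $ r) * \<kappa> $ r $ s * sqrt (\<mu> $ s) * h $ s"
        by (metis (no_types, opaque_lifting) mult.assoc mult.commute times_divide_eq_left)
    qed
    also have "\<dots> = \<sigma> * h $ r" using h(4) by simp
    finally show "(\<Sum>s\<in>UNIV. \<kappa> $ r $ s * \<mu> $ s * (h $ s / sqrt (\<mu> $ s))) = \<sigma> * (h $ r / sqrt (\<mu> $ r))"
      using sq(2)[of r] by (simp add: field_simps)
  qed
qed

lemma exp_gt_add_one: "y > 0 \<Longrightarrow> 1 + y < exp (y::real)"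
proof -
  assume y: "y > 0"
  \<comment> \<open>Squaring the weak bound at \<open>y / 2\<close> makes it strict.\<close>
  have "1 + y < (1 + y / 2) * (1 + y / 2)" using y by (simp add: field_simps)
  also have "\<dots> \<le> exp (y / 2) * exp (y / 2)"
    using y exp_ge_add_one_self[of "y / 2"] by (intro mult_mono) auto
  finally show ?thesis by (simp add: mult_exp_exp)
qed

text \<open>Strict concavity of a function vanishing at 0. Bounding
  \<open>exp (- (\<alpha> - 1) * y)\<close> below by its tangent leaves the positive remainder
  \<open>(\<alpha> - 1) * (1 - (1 + y) * exp (- y))\<close>.\<close>

lemma one_minus_exp_subhomogeneous:
  assumes "\<alpha> > 1" "y > 0"
  shows "1 - exp (- (\<alpha> * y)) < \<alpha> * (1 - exp (- y :: real))"
proof -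
  have "(1 + y) * exp (- y) < exp y * exp (- y)"
    by (intro mult_strict_right_mono exp_gt_add_one assms) simp
  then have "(\<alpha> - 1) * ((1 + y) * exp (- y)) < (\<alpha> - 1) * 1"
    using assms by (intro mult_strict_left_mono) (simp_all add: mult_exp_exp)
  moreover have "1 - (\<alpha> - 1) * y \<le> exp (- (\<alpha> - 1) * y)"
    using exp_ge_add_one_self[of "- (\<alpha> - 1) * y"] by (simp only: minus_mult_left[symmetric])
  then have "exp (- y) * (1 - (\<alpha> - 1) * y) \<le> exp (- y) * exp (- (\<alpha> - 1) * y)"
    by (rule mult_left_mono) simp
  moreover have "exp (- y) * exp (- (\<alpha> - 1) * y) = exp (- (\<alpha> * y))"
    by (simp add: mult_exp_exp algebra_simps)
  ultimately show ?thesis by (simp add: algebra_simps)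
qed

locale survival_equation =
  fixes A :: "'s::finite \<Rightarrow> 's \<Rightarrow> real"
  assumes A_nonneg: "A r s \<ge> 0"
begin

text \<open>Probability that an individual of type \<open>r\<close> has a surviving child, when it
  has independent Poisson numbers of children with means \<open>A r s\<close> and a child of type
  \<open>s\<close> survives with probability \<open>q s\<close>.\<close>

definition step :: "('s \<Rightarrow> real) \<Rightarrow> 's \<Rightarrow> real" where
  "step q r = 1 - exp (- (\<Sum>s\<in>UNIV. A r s * q s))"

lemma step_mono: "(\<And>s. p s \<le> q s) \<Longrightarrow> step p r \<le> step q r"
  by (simp add: step_def sum_mono mult_left_mono A_nonneg)

lemma step_nonneg: "(\<And>s. 0 \<le> q s) \<Longrightarrow> 0 \<le> step q r"
  by (simp add: step_def sum_nonneg A_nonneg)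

lemma step_less_1: "step q r < 1"
  by (simp add: step_def)

text \<open>The largest fixed point is the supremum of all \<open>q\<close> with \<open>q \<le> step q\<close>.\<close>

lemma ex_fixed_point_above:
  assumes f: "\<And>r. 0 \<le> f r" "\<And>r. f r \<le> step f r"
  obtains q where "\<And>r. f r \<le> q r" "\<And>r. step q r = q r"
proof -
  define S where "S = {q. \<forall>r. 0 \<le> q r \<and> q r \<le> step q r}"
  define q where "q r = (SUP p\<in>S. p r)" for r
  have S1: "p r \<le> 1" if "p \<in> S" for p r
    using that step_less_1[of p r] by (auto simp: S_def intro: order_trans less_imp_le)
  have fS: "f \<in> S" using f by (simp add: S_def)
  have up: "p r \<le> q r" if "p \<in> S" for p r
    unfolding q_def using that S1 by (intro cSUP_upper bdd_aboveI[where M = 1]) auto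
  have le: "q r \<le> step q r" for r
    unfolding q_def[of r]
  proof (rule cSUP_least)
    show "S \<noteq> {}" using fS by auto
    fix p assume p: "p \<in> S"
    then have "p r \<le> step p r" by (simp add: S_def)
    also have "\<dots> \<le> step q r" by (rule step_mono) (rule up[OF p])
    finally show "p r \<le> step q r" .
  qed
  have q0: "0 \<le> q r" for r using f(1)[of r] up[OF fS, of r] by simp
  have "step q \<in> S" using q0 le by (simp add: S_def step_nonneg step_mono)
  then have "step q r = q r" for r using up[of "step q" r] le[of r] by simp
  then show thesis using up[OF fS] that by blast
qed

text \<open>Where \<open>q\<close> vanishes the exponent vanishes, so no entry of \<open>A\<close>
  leads from the zero set of \<open>q\<close> to its complement. Irreducibility leaves only the
  empty zero set.\<close>

lemma fixed_point_pos:
  assumes irr: "\<And>I. I \<noteq> {} \<Longrightarrow> I \<noteq> UNIV \<Longrightarrow> \<exists>r\<in>I. \<exists>s\<in>- I. A r s \<noteq> 0"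
    and q: "\<And>r. 0 \<le> q r" "\<And>r. step q r = q r" "q s \<noteq> 0"
  shows "q r > 0"
proof -
  have "A i j = 0" if "q i = 0" "q j \<noteq> 0" for i j
  proof -
    have "(\<Sum>s\<in>UNIV. A i s * q s) = 0" using q(2)[of i] that by (simp add: step_def)
    then have "A i j * q j = 0" using A_nonneg q(1) by (subst (asm) sum_nonneg_eq_0_iff) auto
    then show ?thesis using that by simp
  qed
  then have "{r. q r = 0} = {} \<or> {r. q r = 0} = UNIV" using irr[of "{r. q r = 0}"] by blast
  then have "q r \<noteq> 0" using q(3) by blast
  then show ?thesis using q(1)[of r] by simp
qed

text \<open>At a type \<open>s\<close> with maximal ratio \<open>\<alpha> > 1\<close>, monotonicity
  bounds \<open>q s\<close> by \<open>step\<close> applied to \<alpha> times \<open>p\<close>, and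
  strict subhomogeneity puts this below \<open>\<alpha> * p s = q s\<close>.\<close>

lemma fixed_point_le:
  assumes p: "\<And>r. p r > 0" "\<And>r. step p r = p r" and q: "\<And>r. step q r = q r"
  shows "q r \<le> p r"
proof (rule ccontr)
  assume neg: "\<not> q r \<le> p r"
  define \<alpha> where "\<alpha> = Max (range (\<lambda>s. q s / p s))"
  have le: "q s / p s \<le> \<alpha>" for s by (simp add: \<alpha>_def)
  have "q r / p r > 1" using neg p(1)[of r] by simp
  then have \<alpha>: "\<alpha> > 1" using le[of r] by simp
  have "\<alpha> \<in> range (\<lambda>s. q s / p s)" unfolding \<alpha>_def by (rule Max_in) auto
  then obtain s where s: "q s / p s = \<alpha>" by auto
  define y where "y = (\<Sum>j\<in>UNIV. A s j * p j)"
  have "q j \<le> \<alpha> * p j" for j using le[of j] p(1)[of j] by (simp add: field_simps)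
  then have "q s \<le> step (\<lambda>j. \<alpha> * p j) s" unfolding q[of s, symmetric] by (rule step_mono)
  also have "\<dots> = 1 - exp (- (\<alpha> * y))" by (simp add: step_def y_def sum_distrib_left mult_ac)
  also have "\<dots> < \<alpha> * (1 - exp (- y))"
  proof (rule one_minus_exp_subhomogeneous[OF \<alpha>])
    have "1 - exp (- y) > 0" using p(1)[of s] unfolding y_def p(2)[of s, unfolded step_def] .
    then show "y > 0" by simp
  qed
  also have "1 - exp (- y) = p s" using p(2)[of s] by (simp add: step_def y_def)
  finally show False using s p(1)[of s] by (simp add: field_simps)
qed

end

text \<open>With \<open>c = \<mu> (1 - q)\<close>, dividing the duality equation by \<mu> expresses
  \<open>1 - q\<close> as an exponential of \<kappa> applied to \<open>\<mu> - c = \<mu> q\<close>.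
  The conditions \<open>c \<le> \<mu>\<close> and \<open>c \<noteq> \<mu>\<close> become
  \<open>q \<ge> 0\<close> and \<open>q \<noteq> 0\<close>.\<close>

lemma is_dual_vector_iff:
  fixes \<kappa> :: "real^'s^'s::finite" and t :: real
  assumes \<mu>: "\<And>r. \<mu> $ r > 0"
  defines "A \<equiv> \<lambda>r s. t * \<kappa> $ r $ s * \<mu> $ s"
  defines "q \<equiv> \<lambda>c r. 1 - c $ r / \<mu> $ r"
  shows "is_dual_vector \<kappa> \<mu> t c \<longleftrightarrow> (\<forall>r. 0 \<le> c $ r) \<and> (\<forall>r. 0 \<le> q c r) \<and> (\<exists>r. q c r \<noteq> 0) \<and>
    (\<forall>r. 1 - exp (- (\<Sum>s\<in>UNIV. A r s * q c s)) = q c r)"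
proof -
  have mu0: "\<mu> $ r \<noteq> 0" for r using \<mu>[of r] by simp
  have *: "(\<Sum>s\<in>UNIV. A r s * q c s) = t * (\<kappa> *v \<mu>) $ r - t * (\<kappa> *v c) $ r" for r
    unfolding matrix_vector_mult_def vec_lambda_beta sum_distrib_left sum_subtractf[symmetric]
    by (intro sum.cong refl) (simp add: A_def q_def mu0 field_simps)
  have "exp (- t * (\<kappa> *v c) $ r) * c $ r = exp (- t * (\<kappa> *v \<mu>) $ r) * \<mu> $ r \<longleftrightarrow>
      1 - exp (- (\<Sum>s\<in>UNIV. A r s * q c s)) = q c r" for r
  proof -
    have "exp (- t * (\<kappa> *v c) $ r) * c $ r = exp (- t * (\<kappa> *v \<mu>) $ r) * \<mu> $ r \<longleftrightarrow>
        c $ r = exp (t * (\<kappa> *v c) $ r - t * (\<kappa> *v \<mu>) $ r) * \<mu> $ r"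
      by (simp add: exp_diff exp_minus field_simps)
    also have "\<dots> \<longleftrightarrow> 1 - exp (- (\<Sum>s\<in>UNIV. A r s * q c s)) = q c r"
      unfolding * by (simp add: q_def mu0 field_simps)
    finally show ?thesis .
  qed
  moreover have "c $ r \<le> \<mu> $ r \<longleftrightarrow> 0 \<le> q c r" for r using \<mu>[of r] by (simp add: q_def)
  moreover have "c \<noteq> \<mu> \<longleftrightarrow> (\<exists>r. q c r \<noteq> 0)"
    by (simp add: vec_eq_iff q_def mu0) metis
  ultimately show ?thesis by (auto simp: is_dual_vector_def)
qed

text \<open>The eigenfunction is scaled down until the linear growth by \<open>\<sigma> > 1\<close>
  outweighs the concavity of \<open>step\<close>, which gives a subsolution and hence a fixed point.
  Uniqueness follows by bounding two positive fixed points by each other.\<close>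

theorem ex1_dual_vector:
  fixes \<kappa> :: "real^'s^'s::finite"
  assumes \<mu>: "\<And>r. \<mu> $ r > 0" and nn: "\<And>r s. \<kappa> $ r $ s \<ge> 0" and sym: "transpose \<kappa> = \<kappa>"
    and irr: "irreducible_matrix \<kappa>" and t: "t > 0" and gt: "Sigma_norm (t *\<^sub>R \<kappa>) \<mu> > 1"
  shows "\<exists>!c. is_dual_vector \<kappa> \<mu> t c"
proof -
  define A where "A r s = t * \<kappa> $ r $ s * \<mu> $ s" for r s
  interpret survival_equation A
    by standard (use t nn \<mu> in \<open>simp add: A_def less_imp_le\<close>)
  let ?q = "\<lambda>c r. 1 - c $ r / \<mu> $ r"
  have mu0: "\<mu> $ r \<noteq> 0" for r using \<mu>[of r] by simp
  have dual: "is_dual_vector \<kappa> \<mu> t c \<longleftrightarrow> (\<forall>r. 0 \<le> c $ r) \<and> (\<forall>r. 0 \<le> ?q c r) \<and> (\<exists>r. ?q c r \<noteq> 0) \<and>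
      (\<forall>r. step (?q c) r = ?q c r)" for c
    unfolding is_dual_vector_iff[OF \<mu>] step_def A_def ..
  have irrA: "\<exists>r\<in>I. \<exists>s\<in>- I. A r s \<noteq> 0" if "I \<noteq> {}" "I \<noteq> UNIV" for I
    using irr that t mu0 by (simp add: irreducible_matrix_def A_def) blast
  have "\<exists>c. is_dual_vector \<kappa> \<mu> t c"
  proof -
    have "transpose (t *\<^sub>R \<kappa>) = t *\<^sub>R \<kappa>"
      using sym by (simp add: transpose_def vec_eq_iff)
    moreover have "(t *\<^sub>R \<kappa>) $ r $ s \<ge> 0" for r s using t nn by simp
    ultimately obtain f \<sigma> where f: "\<sigma> > 1" "\<And>r. f r \<ge> 0" "\<exists>r. f r \<noteq> 0"
      "\<And>r. (\<Sum>s\<in>UNIV. (t *\<^sub>R \<kappa>) $ r $ s * \<mu> $ s * f s) = \<sigma> * f r"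
      using Sigma_norm_gt_1_eigenfunction[OF _ _ \<mu> gt] by metis
    define F where "F = Max (range f)"
    have F: "f r \<le> F" for r by (simp add: F_def)
    obtain r0 where "f r0 > 0" using f(2,3) by (metis less_eq_real_def)
    then have Fp: "F > 0" using F[of r0] by simp
    text \<open>\<open>\<epsilon>\<close> is chosen such that \<open>exp z \<ge> 1 + z\<close> at \<open>z = \<epsilon> \<sigma> f r\<close> gives
      \<open>1 - exp (- z) \<ge> z / (1 + z) \<ge> z / \<sigma>\<close>.\<close>
    define \<epsilon> where "\<epsilon> = (\<sigma> - 1) / (\<sigma> * F)"
    have \<epsilon>: "\<epsilon> > 0" using f(1) Fp by (simp add: \<epsilon>_def)
    have sub: "\<epsilon> * f r \<le> step (\<lambda>s. \<epsilon> * f s) r" for r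
    proof -
      define z where "z = \<epsilon> * \<sigma> * f r"
      have z0: "z \<ge> 0" using \<epsilon> f(1,2) by (simp add: z_def)
      have "z \<le> \<epsilon> * \<sigma> * F" unfolding z_def using \<epsilon> f(1) F by (intro mult_left_mono) auto
      also have "\<dots> = \<sigma> - 1" using f(1) Fp by (simp add: \<epsilon>_def)
      finally have z1: "1 + z \<le> \<sigma>" by simp
      have "exp (- z) \<le> 1 / (1 + z)"
        using exp_ge_add_one_self[of z] z0 by (simp add: exp_minus field_simps)
      then have "1 - exp (- z) \<ge> z / (1 + z)" using z0 by (simp add: field_simps)
      moreover have "z / \<sigma> \<le> z / (1 + z)" using z0 z1 by (intro divide_left_mono) auto
      moreover have "\<epsilon> * f r = z / \<sigma>" using f(1) by (simp add: z_def)
      moreover have "(\<Sum>s\<in>UNIV. A r s * (\<epsilon> * f s)) = \<epsilon> * (\<Sum>s\<in>UNIV. (t *\<^sub>R \<kappa>) $ r $ s * \<mu> $ s * f s)"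
        unfolding sum_distrib_left by (intro sum.cong refl) (simp add: A_def mult_ac)
      then have "step (\<lambda>s. \<epsilon> * f s) r = 1 - exp (- z)"
        unfolding step_def f(4) z_def by (simp add: mult.assoc)
      ultimately show ?thesis by simp
    qed
    have "0 \<le> \<epsilon> * f r" for r using \<epsilon> f(2) by simp
    from ex_fixed_point_above[OF this sub] obtain q
      where q: "\<And>r. \<epsilon> * f r \<le> q r" "\<And>r. step q r = q r" by blast
    define c where "c = (\<chi> r. \<mu> $ r * (1 - q r))"
    have qc: "?q c = q" by (rule ext) (simp add: c_def mu0)
    have "0 \<le> q r" for r using q(1)[of r] \<epsilon> f(2)[of r] by (meson mult_nonneg_nonneg less_imp_le order_trans)
    moreover have "0 \<le> c $ r" for r
      using step_less_1[of q r] q(2)[of r] \<mu>[of r] by (simp add: c_def)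
    moreover have "q r0 \<noteq> 0" using q(1)[of r0] \<epsilon> \<open>f r0 > 0\<close> by (smt (verit) mult_pos_pos)
    ultimately have "is_dual_vector \<kappa> \<mu> t c" unfolding dual qc fun_cong[OF qc] using q(2) by blast
    then show ?thesis ..
  qed
  moreover have "c = c'" if "is_dual_vector \<kappa> \<mu> t c" "is_dual_vector \<kappa> \<mu> t c'" for c c'
  proof -
    have pos: "?q d r > 0" and fixed: "step (?q d) r = ?q d r" if "is_dual_vector \<kappa> \<mu> t d" for d r
      using that fixed_point_pos[of "?q d", OF irrA] unfolding dual by blast+
    have "?q c r = ?q c' r" for r
      using fixed_point_le[of "?q c" "?q c'" r] fixed_point_le[of "?q c'" "?q c" r] pos fixed that
      by (intro antisym) blast+
    then show ?thesis by (simp add: vec_eq_iff mu0)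
  qed
  ultimately show ?thesis by blast
qed

section \<open>The component densities\<close>

text \<open>This is \<open>K(k, \<mu>)\<close>, the integral of the kernel at \<open>k\<close>
  against \<open>\<lambda>\<^sub>0\<close>.\<close>

definition collision_rate :: "real^'s^'s::finite \<Rightarrow> real^'s \<Rightarrow> nat^'s \<Rightarrow> real" where
  "collision_rate \<kappa> \<mu> k = (\<Sum>r\<in>UNIV. real (k $ r) * (\<kappa> *v \<mu>) $ r)"

definition component_density :: "real^'s^'s::finite \<Rightarrow> real^'s \<Rightarrow> real \<Rightarrow> nat^'s \<Rightarrow> real" where
  "component_density \<kappa> \<mu> t k =
     tree_coeff \<kappa> k * (\<Prod>r\<in>UNIV. \<mu> $ r ^ (k $ r)) * (t ^ (vsize k - 1) * exp (- t * collision_rate \<kappa> \<mu> k))"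

lemma cluster_weight_eq_component_density:
  assumes "transpose \<kappa> = \<kappa>"
  shows "cluster_weight \<kappa> t \<mu> k = component_density \<kappa> \<mu> t k"
proof -
  have "(\<Prod>s\<in>UNIV. (\<mu> $ s * exp (- t * (\<kappa> *v \<mu>) $ s)) ^ (k $ s) / fact (k $ s)) =
      (\<Prod>s\<in>UNIV. \<mu> $ s ^ (k $ s) * exp (real (k $ s) * (- t * (\<kappa> *v \<mu>) $ s)) / fact (k $ s))"
    by (simp only: power_mult_distrib exp_of_nat_mult)
  also have "\<dots> = (\<Prod>s\<in>UNIV. \<mu> $ s ^ (k $ s)) * (\<Prod>s\<in>UNIV. exp (real (k $ s) * (- t * (\<kappa> *v \<mu>) $ s))) /
      (\<Prod>s\<in>UNIV. fact (k $ s))"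
    by (simp add: prod.distrib prod_dividef)
  also have "(\<Prod>s\<in>UNIV. exp (real (k $ s) * (- t * (\<kappa> *v \<mu>) $ s))) = exp (- t * collision_rate \<kappa> \<mu> k)"
    by (simp add: exp_sum[symmetric] collision_rate_def sum_distrib_left sum_negf mult_ac)
  finally show ?thesis
    unfolding cluster_weight_def component_density_def tree_coeff_def tree_weight_scale[OF assms, of t]
    by simp
qed

lemma cluster_weight_dual:
  assumes "is_dual_vector \<kappa> \<mu> t c"
  shows "cluster_weight \<kappa> t c = cluster_weight \<kappa> t \<mu>"
proof -
  have "c $ s * exp (- t * (\<kappa> *v c) $ s) = \<mu> $ s * exp (- t * (\<kappa> *v \<mu>) $ s)" for s
    using assms by (simp add: is_dual_vector_def mult.commute)
  then show ?thesis by (simp add: cluster_weight_def fun_eq_iff)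
qed

text \<open>The factor \<open>0 ^ (|k| - 1)\<close> is 1 for unit vectors and 0 for larger sizes.
  For \<open>k = 0\<close> it is again 1 by truncated subtraction, and there the tree weight 0
  settles the matter.\<close>

lemma component_density_0:
  fixes \<kappa> :: "real^'s^'s::finite"
  assumes sym: "transpose \<kappa> = \<kappa>"
  shows "component_density \<kappa> \<mu> 0 k = (\<Sum>r\<in>UNIV. \<mu> $ r * indicator {axis r 1} k)"
proof (cases "\<exists>r. k = axis r 1")
  case True
  then obtain r where k: "k = axis r 1" by blast
  have inj: "axis r (1::nat) = axis s 1 \<longleftrightarrow> s = r" for r s :: 's by (auto simp: axis_eq_axis)
  have vs: "vsize k = 1" by (simp add: k axis_def)
  have "(\<Prod>s\<in>UNIV. fact (k $ s)) = (1::real)"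
    by (rule prod.neutral) (auto simp: k axis_def)
  moreover have "(\<Prod>s\<in>UNIV. \<mu> $ s ^ (k $ s)) = \<mu> $ r"
  proof -
    have "(\<Prod>s\<in>UNIV. \<mu> $ s ^ (k $ s)) = (\<Prod>s\<in>UNIV. if s = r then \<mu> $ s else 1)"
      by (intro prod.cong) (auto simp: k axis_def)
    then show ?thesis by simp
  qed
  moreover have "tree_weight \<kappa> 1 k = 1" unfolding k by (rule tree_weight_axis[OF sym])
  ultimately have "component_density \<kappa> \<mu> 0 k = \<mu> $ r"
    unfolding component_density_def vs tree_coeff_def by simp
  moreover have "(\<Sum>s\<in>UNIV. \<mu> $ s * indicator {axis s 1} k) = (\<Sum>s\<in>UNIV. if s = r then \<mu> $ s else 0)"
    by (intro sum.cong) (auto simp: k inj indicator_def simp del: One_nat_def)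
  ultimately show ?thesis by simp
next
  case False
  have "component_density \<kappa> \<mu> 0 k = 0"
  proof (cases "k = 0")
    case True
    then show ?thesis by (simp add: component_density_def tree_coeff_def tree_weight_def)
  next
    case nz: False
    have "vsize k \<noteq> 1"
    proof
      assume vs: "vsize k = 1"
      obtain r where r: "k $ r \<noteq> 0" using nz by (auto simp: vec_eq_iff)
      have split: "vsize k = k $ r + (\<Sum>s\<in>UNIV - {r}. k $ s)" by (rule sum.remove) auto
      have "k $ r = 1" and rest: "(\<Sum>s\<in>UNIV - {r}. k $ s) = 0" using split vs r by linarith+
      moreover have "k $ s = 0" if "s \<noteq> r" for s
        using rest that by (subst (asm) sum_eq_0_iff) auto
      ultimately have "k = axis r 1" by (auto simp: vec_eq_iff axis_def)
      then show False using False by blast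
    qed
    moreover have "vsize k \<noteq> 0" using nz vsize_eq_0_iff[of k] by simp
    ultimately have "(0::real) ^ (vsize k - 1) = 0" by (intro zero_power) linarith
    then show ?thesis by (simp add: component_density_def)
  qed
  moreover have "(\<Sum>s\<in>UNIV. \<mu> $ s * indicator {axis s 1} k) = 0"
    using False by (intro sum.neutral) (auto simp: indicator_def)
  ultimately show ?thesis by simp
qed

lemma coag_kernel_sym:
  assumes "transpose \<kappa> = \<kappa>" shows "coag_kernel \<kappa> j l = coag_kernel \<kappa> l j"
proof -
  have "\<kappa> $ r $ s = \<kappa> $ s $ r" for r s using assms by (metis transpose_def vec_lambda_beta)
  then have "coag_kernel \<kappa> j l = (\<Sum>r\<in>UNIV. \<Sum>s\<in>UNIV. \<kappa> $ s $ r * real (l $ s) * real (j $ r))"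
    unfolding coag_kernel_def by (intro sum.cong refl) (simp add: mult_ac)
  also have "\<dots> = coag_kernel \<kappa> l j" unfolding coag_kernel_def by (rule sum.swap)
  finally show ?thesis .
qed

lemma coag_kernel_expand:
  "coag_kernel \<kappa> j l = (\<Sum>s\<in>UNIV. (\<Sum>r\<in>UNIV. \<kappa> $ r $ s * real (j $ r)) * real (l $ s))"
  unfolding coag_kernel_def sum_distrib_right by (rule sum.swap)

text \<open>Same linear form as in \<open>coag_kernel_expand\<close>, with \<mu> in place of the
  second argument: a bound of moments by \<mu> becomes a bound of the gain by the loss.\<close>

lemma collision_rate_expand:
  "collision_rate \<kappa> \<mu> j = (\<Sum>s\<in>UNIV. (\<Sum>r\<in>UNIV. \<kappa> $ r $ s * real (j $ r)) * \<mu> $ s)"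
  unfolding collision_rate_def matrix_vector_mult_def vec_lambda_beta sum_distrib_right sum_distrib_left
  by (subst sum.swap) (simp add: mult_ac)

lemma finite_vsize_le: "finite {k :: nat^'s::finite. vsize k \<le> n}"
proof (rule finite_subset)
  show "{k. vsize k \<le> n} \<subseteq> {j :: nat^'s. \<forall>r. j $ r \<le> (\<chi> _. n) $ r}"
  proof clarify
    fix k :: "nat^'s" and r assume "vsize k \<le> n"
    moreover have "k $ r \<le> vsize k" by (rule member_le_sum) auto
    ultimately show "k $ r \<le> (\<chi> _. n) $ r" by simp
  qed
qed (rule finite_vec_le)

section \<open>Evolution of the densities and of their truncated first moments\<close>

locale flory_setup =
  fixes \<kappa> :: "real^'s^'s::finite" and \<mu> :: "real^'s"
  assumes sym: "transpose \<kappa> = \<kappa>" and nonneg: "\<kappa> $ r $ s \<ge> 0" and pos: "\<mu> $ r > 0"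
begin

abbreviation dens :: "real \<Rightarrow> nat^'s \<Rightarrow> real" where
  "dens \<equiv> component_density \<kappa> \<mu>"

abbreviation coag_gain :: "real \<Rightarrow> (nat^'s) \<times> (nat^'s) \<Rightarrow> real" where
  "coag_gain t \<equiv> \<lambda>(j, l). coag_kernel \<kappa> j l * dens t j * dens t l"

lemma dens_nonneg: "t \<ge> 0 \<Longrightarrow> dens t k \<ge> 0"
  unfolding component_density_def
  by (intro mult_nonneg_nonneg prod_nonneg tree_coeff_nonneg) (auto simp: nonneg pos less_imp_le)

lemma dens_zero [simp]: "dens t 0 = 0"
  by (simp add: component_density_def tree_coeff_def tree_weight_def)

text \<open>For nonzero parts the factors in \<open>t\<close> and \<mu> depend on
  \<open>j + l\<close> only, so they come out of the sum and \<open>tree_coeff_recursion\<close>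
  evaluates the rest. Splittings with a zero part vanish.\<close>

lemma coag_gain_sum:
  "(\<Sum>p | fst p + snd p = k. coag_gain t p) =
     2 * real (vsize k - 1) * tree_coeff \<kappa> k * (\<Prod>r\<in>UNIV. \<mu> $ r ^ (k $ r)) *
       (t ^ (vsize k - 2) * exp (- t * collision_rate \<kappa> \<mu> k))"
proof -
  have "coag_gain t (j, l) = (coag_kernel \<kappa> j l * tree_coeff \<kappa> j * tree_coeff \<kappa> l) *
      ((\<Prod>r\<in>UNIV. \<mu> $ r ^ (k $ r)) * (t ^ (vsize k - 2) * exp (- t * collision_rate \<kappa> \<mu> k)))"
    if jl: "j + l = k" for j l
  proof (cases "j = 0 \<or> l = 0")
    case False
    then have "vsize j \<noteq> 0" "vsize l \<noteq> 0" using vsize_eq_0_iff by blast+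
    moreover have "vsize k = vsize j + vsize l" by (simp add: jl[symmetric] sum.distrib)
    ultimately have "vsize k - 2 = (vsize j - 1) + (vsize l - 1)" by linarith
    moreover have "collision_rate \<kappa> \<mu> k = collision_rate \<kappa> \<mu> j + collision_rate \<kappa> \<mu> l"
      by (simp add: collision_rate_def jl[symmetric] distrib_right sum.distrib)
    moreover have "(\<Prod>r\<in>UNIV. \<mu> $ r ^ (k $ r)) = (\<Prod>r\<in>UNIV. \<mu> $ r ^ (j $ r)) * (\<Prod>r\<in>UNIV. \<mu> $ r ^ (l $ r))"
      by (simp add: jl[symmetric] power_add prod.distrib)
    ultimately show ?thesis
      by (simp add: component_density_def power_add distrib_left exp_add exp_diff exp_minus field_simps)
  qed auto
  then have "(\<Sum>p | fst p + snd p = k. coag_gain t p) =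
     (\<Sum>(j, l) | j + l = k. coag_kernel \<kappa> j l * tree_coeff \<kappa> j * tree_coeff \<kappa> l) *
      ((\<Prod>r\<in>UNIV. \<mu> $ r ^ (k $ r)) * (t ^ (vsize k - 2) * exp (- t * collision_rate \<kappa> \<mu> k)))"
    unfolding sum_distrib_right by (intro sum.cong) (auto simp: case_prod_unfold)
  then show ?thesis unfolding tree_coeff_recursion[OF sym, symmetric] by (simp only: mult.assoc)
qed

text \<open>Product rule: the power of \<open>t\<close> yields half of \<open>coag_gain_sum\<close>,
  the exponential yields the loss. The derivative is two-sided at every real \<open>t\<close>, so
  its restriction serves at 0.\<close>

lemma dens_deriv:
  "((\<lambda>u. dens u k) has_real_derivative
     1 / 2 * (\<Sum>p | fst p + snd p = k. coag_gain t p) - dens t k * collision_rate \<kappa> \<mu> k) (at t)"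
proof -
  have "vsize k - 1 - Suc 0 = vsize k - 2" by simp
  then show ?thesis
    unfolding coag_gain_sum unfolding component_density_def
    by (auto intro!: derivative_eq_intros simp: algebra_simps)
qed

text \<open>The cutoff by size keeps the sum finite, so it can be differentiated termwise before
  anything is known about convergence.\<close>

definition moment :: "nat \<Rightarrow> 's \<Rightarrow> real \<Rightarrow> real" where
  "moment n s t = (\<Sum>k | vsize k \<le> n. real (k $ s) * dens t k)"

text \<open>A component \<open>j\<close> keeps its mass below the cutoff when it meets a partner of
  size at most \<open>n - |j|\<close>, but is lost at the full rate
  \<open>K(j, \<mu>)\<close>.\<close>

lemma moment_deriv:
  "((\<lambda>u. moment n s u) has_real_derivative
     (\<Sum>j | vsize j \<le> n. real (j $ s) * dens t j *
        ((\<Sum>i\<in>UNIV. (\<Sum>r\<in>UNIV. \<kappa> $ r $ i * real (j $ r)) * moment (n - vsize j) i t)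
          - collision_rate \<kappa> \<mu> j))) (at t)"
proof -
  let ?B = "\<lambda>n. {k :: nat^'s. vsize k \<le> n}"
  let ?S = "{p :: (nat^'s) \<times> (nat^'s). vsize (fst p + snd p) \<le> n}"
  have vadd: "vsize (j + l) = vsize j + vsize l" for j l :: "nat^'s" by (simp add: sum.distrib)
  have S: "?S = Sigma (?B n) (\<lambda>j. ?B (n - vsize j))" by (auto simp: sum.distrib)
  have finS: "finite ?S" unfolding S by (intro finite_SigmaI finite_vsize_le)
  let ?h = "\<lambda>p. real ((fst p + snd p) $ s) * coag_gain t p"
  have "(\<Sum>k\<in>?B n. real (k $ s) * (\<Sum>p | fst p + snd p = k. coag_gain t p)) =
     (\<Sum>k\<in>?B n. \<Sum>p\<in>{p \<in> ?S. fst p + snd p = k}. ?h p)"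
  proof (rule sum.cong[OF refl])
    fix k assume k: "k \<in> ?B n"
    then have "{p \<in> ?S. fst p + snd p = k} = {p. fst p + snd p = k}" by auto
    then show "real (k $ s) * (\<Sum>p | fst p + snd p = k. coag_gain t p) = (\<Sum>p\<in>{p \<in> ?S. fst p + snd p = k}. ?h p)"
      unfolding sum_distrib_left by (intro sum.cong) auto
  qed
  also have "\<dots> = (\<Sum>p\<in>?S. ?h p)"
    by (rule sum.group[OF finS finite_vsize_le]) auto
  also have "\<dots> = (\<Sum>p\<in>?S. real (fst p $ s) * coag_gain t p) + (\<Sum>p\<in>?S. real (snd p $ s) * coag_gain t p)"
    by (simp add: distrib_right sum.distrib)
  \<comment> \<open>Both parts of a pair contribute equally by symmetry of the kernel, which absorbs
    the factor 1/2.\<close>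
  also have "(\<Sum>p\<in>?S. real (snd p $ s) * coag_gain t p) = (\<Sum>p\<in>?S. real (fst p $ s) * coag_gain t p)"
    by (rule sum.reindex_bij_witness[where i = prod.swap and j = prod.swap])
      (auto simp: add.commute coag_kernel_sym[OF sym] mult_ac)
  finally have "1 / 2 * (\<Sum>k\<in>?B n. real (k $ s) * (\<Sum>p | fst p + snd p = k. coag_gain t p)) =
      (\<Sum>p\<in>?S. real (fst p $ s) * coag_gain t p)"
    by simp
  then have "(\<Sum>k\<in>?B n. real (k $ s) * (1 / 2 * (\<Sum>p | fst p + snd p = k. coag_gain t p))) =
      (\<Sum>p\<in>?S. real (fst p $ s) * coag_gain t p)"
    by (simp only: mult.left_commute[of _ "1 / 2"] sum_distrib_left[symmetric])
  also have "\<dots> = (\<Sum>j\<in>?B n. \<Sum>l\<in>?B (n - vsize j). real (j $ s) * coag_gain t (j, l))"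
    unfolding S by (subst sum.Sigma) (auto simp: finite_vsize_le case_prod_unfold)
  also have "\<dots> = (\<Sum>j\<in>?B n. real (j $ s) * dens t j *
        (\<Sum>i\<in>UNIV. (\<Sum>r\<in>UNIV. \<kappa> $ r $ i * real (j $ r)) * moment (n - vsize j) i t))"
  proof (rule sum.cong[OF refl])
    fix j
    have "(\<Sum>l\<in>?B (n - vsize j). real (j $ s) * coag_gain t (j, l)) =
       real (j $ s) * dens t j * (\<Sum>l\<in>?B (n - vsize j). coag_kernel \<kappa> j l * dens t l)"
      by (simp add: sum_distrib_left mult_ac)
    also have "(\<Sum>l\<in>?B (n - vsize j). coag_kernel \<kappa> j l * dens t l) =
       (\<Sum>i\<in>UNIV. (\<Sum>r\<in>UNIV. \<kappa> $ r $ i * real (j $ r)) * moment (n - vsize j) i t)"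
    proof -
      define c where "c i = (\<Sum>r\<in>UNIV. \<kappa> $ r $ i * real (j $ r))" for i
      have "(\<Sum>l\<in>?B (n - vsize j). coag_kernel \<kappa> j l * dens t l) =
          (\<Sum>l\<in>?B (n - vsize j). \<Sum>i\<in>UNIV. c i * (real (l $ i) * dens t l))"
        unfolding coag_kernel_expand c_def[symmetric] by (simp add: sum_distrib_right mult.assoc)
      also have "\<dots> = (\<Sum>i\<in>UNIV. c i * moment (n - vsize j) i t)"
        unfolding moment_def sum_distrib_left by (rule sum.swap)
      finally show ?thesis by (simp add: c_def)
    qed
    finally show "(\<Sum>l\<in>?B (n - vsize j). real (j $ s) * coag_gain t (j, l)) = real (j $ s) * dens t j *
        (\<Sum>i\<in>UNIV. (\<Sum>r\<in>UNIV. \<kappa> $ r $ i * real (j $ r)) * moment (n - vsize j) i t)" .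
  qed
  finally have gain: "(\<Sum>k\<in>?B n. real (k $ s) * (1 / 2 * (\<Sum>p | fst p + snd p = k. coag_gain t p))) =
      (\<Sum>j\<in>?B n. real (j $ s) * dens t j *
        (\<Sum>i\<in>UNIV. (\<Sum>r\<in>UNIV. \<kappa> $ r $ i * real (j $ r)) * moment (n - vsize j) i t))" .
  have "((\<lambda>u. moment n s u) has_real_derivative
     (\<Sum>k\<in>?B n. real (k $ s) * (1 / 2 * (\<Sum>p | fst p + snd p = k. coag_gain t p) - dens t k * collision_rate \<kappa> \<mu> k))) (at t)"
    unfolding moment_def by (intro DERIV_sum DERIV_cmult dens_deriv)
  then show ?thesis
    unfolding right_diff_distrib sum_subtractf gain by (simp only: mult.assoc)
qed

text \<open>Coagulation of masses below the cutoff only removes mass, and a component of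
  positive size can only be joined to one of size at most \<open>n - 1\<close>.\<close>

lemma moment_le: "t \<ge> 0 \<Longrightarrow> moment n s t \<le> \<mu> $ s"
proof (induction n arbitrary: s t rule: less_induct)
  case (less n)
  have "moment n s t \<le> moment n s 0"
  proof (rule DERIV_nonpos_imp_nonincreasing[OF less.prems])
    fix x :: real assume x: "0 \<le> x" "x \<le> t"
    have "real (j $ s) * dens x j *
        ((\<Sum>i\<in>UNIV. (\<Sum>r\<in>UNIV. \<kappa> $ r $ i * real (j $ r)) * moment (n - vsize j) i x)
          - collision_rate \<kappa> \<mu> j) \<le> 0" if j: "vsize j \<le> n" for j
    proof (cases "j = 0")
      case False
      then have "n - vsize j < n" using j vsize_eq_0_iff[of j] by linarith
      then have "moment (n - vsize j) i x \<le> \<mu> $ i" for i using less.IH x by blast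
      then have "(\<Sum>i\<in>UNIV. (\<Sum>r\<in>UNIV. \<kappa> $ r $ i * real (j $ r)) * moment (n - vsize j) i x) \<le> collision_rate \<kappa> \<mu> j"
        unfolding collision_rate_expand
        by (intro sum_mono mult_left_mono sum_nonneg mult_nonneg_nonneg) (auto simp: nonneg)
      then show ?thesis using x dens_nonneg[of x j] by (intro mult_nonneg_nonpos) auto
    qed simp
    then show "\<exists>y. (moment n s has_real_derivative y) (at x) \<and> y \<le> 0"
      using moment_deriv[of n s x] by (intro exI conjI) (auto intro!: sum_nonpos)
  qed
  \<comment> \<open>Only unit vectors carry mass at time 0. For \<open>n = 0\<close> even these are
    cut off, whence an inequality.\<close>
  also have "moment n s 0 = (\<Sum>r\<in>UNIV. \<mu> $ r * (\<Sum>k | vsize k \<le> n. real (k $ s) * indicator {axis r 1} k))"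
    unfolding moment_def component_density_0[OF sym] sum_distrib_left
    by (subst sum.swap) (simp add: mult_ac)
  also have "\<dots> \<le> (\<Sum>r\<in>UNIV. \<mu> $ r * (if r = s then 1 else 0))"
  proof (intro sum_mono mult_left_mono)
    fix r
    have "(\<Sum>k | vsize k \<le> n. real (k $ s) * indicator {axis r 1} k) =
        (\<Sum>k\<in>{k. vsize k \<le> n} \<inter> {axis r 1}. real (k $ s))"
      by (rule sum.mono_neutral_cong_right) (auto simp: finite_vsize_le)
    also have "\<dots> \<le> (\<Sum>k\<in>{axis r 1}. real (k $ s))"
      by (rule sum_mono2) auto
    also have "\<dots> = (if r = s then 1 else 0)" by (auto simp: axis_def)
    finally show "(\<Sum>k | vsize k \<le> n. real (k $ s) * indicator {axis r 1} k) \<le> (if r = s then 1 else (0::real))" .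
  qed (simp add: pos less_imp_le)
  also have "\<dots> = \<mu> $ s" by (simp add: if_distrib cong: if_cong)
  finally show ?case .
qed

text \<open>Any finite set of vectors lies below some cutoff, so all partial sums are bounded by
  \<open>\<mu> $ s\<close>.\<close>

lemma moment_summable:
  assumes "t \<ge> 0"
  shows "integrable (count_space UNIV) (\<lambda>k. dens t k * real (k $ s))"
proof -
  have "(\<lambda>k. norm (dens t k * real (k $ s))) summable_on UNIV"
  proof (rule nonneg_bdd_above_summable_on)
    show "bdd_above (sum (\<lambda>k. norm (dens t k * real (k $ s))) ` {F. F \<subseteq> UNIV \<and> finite F})"
    proof (rule bdd_aboveI2[where M = "\<mu> $ s"])
      fix F :: "(nat^'s) set" assume "F \<in> {F. F \<subseteq> UNIV \<and> finite F}"
      then have F: "finite F" by simp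
      define n where "n = Max (insert 0 (vsize ` F))"
      have "(\<Sum>k\<in>F. norm (dens t k * real (k $ s))) = (\<Sum>k\<in>F. real (k $ s) * dens t k)"
        using dens_nonneg[OF assms] by (simp add: abs_mult mult.commute)
      also have "\<dots> \<le> moment n s t"
        unfolding moment_def using F dens_nonneg[OF assms]
        by (intro sum_mono2) (auto simp: finite_vsize_le n_def)
      also have "\<dots> \<le> \<mu> $ s" by (rule moment_le[OF assms])
      finally show "(\<Sum>k\<in>F. norm (dens t k * real (k $ s))) \<le> \<mu> $ s" .
    qed
  qed simp
  then show ?thesis
    by (rule iffD1[OF abs_summable_equivalent[unfolded abs_summable_on_def]])
qed

end

section \<open>Integration against point measures\<close>

lemma integrable_point_measure:
  fixes f :: "'a \<Rightarrow> real"
  assumes "\<And>x. a x \<ge> 0"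
  shows "integrable (point_measure UNIV (\<lambda>x. ennreal (a x))) f \<longleftrightarrow> integrable (count_space UNIV) (\<lambda>x. a x * f x)"
  unfolding point_measure_def using assms by (subst integrable_density) (auto simp: AE_count_space)

lemma integral_point_measure:
  fixes f :: "'a \<Rightarrow> real"
  assumes "\<And>x. a x \<ge> 0"
  shows "integral\<^sup>L (point_measure UNIV (\<lambda>x. ennreal (a x))) f = (\<integral>x. a x * f x \<partial>count_space UNIV)"
  unfolding point_measure_def using assms by (subst integral_density) (auto simp: AE_count_space)

text \<open>Finite support is asked of the product of density and integrand: in the gain term the
  integrand provides it, in the loss term the initial measure helps.\<close>

lemma point_measure_finite_support:
  fixes f :: "'a \<Rightarrow> real"
  assumes a: "\<And>x. a x \<ge> 0" and F: "finite F" "\<And>x. x \<notin> F \<Longrightarrow> a x * f x = 0"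
  shows "integrable (point_measure UNIV (\<lambda>x. ennreal (a x))) f"
    and "integral\<^sup>L (point_measure UNIV (\<lambda>x. ennreal (a x))) f = (\<Sum>x\<in>F. a x * f x)"
proof -
  have fin: "finite {x. a x * f x \<noteq> 0}" by (rule finite_subset[OF _ F(1)]) (use F(2) in blast)
  have "integrable (count_space UNIV) (\<lambda>x. a x * f x)"
  proof -
    have "Infinite_Set_Sum.abs_summable_on (\<lambda>x. a x * f x) F" using F(1) by simp
    then have "Infinite_Set_Sum.abs_summable_on (\<lambda>x. a x * f x) UNIV"
      by (subst abs_summable_on_cong_neutral[where B = F]) (use F(2) in auto)
    then show ?thesis by (simp only: abs_summable_on_def)
  qed
  then show "integrable (point_measure UNIV (\<lambda>x. ennreal (a x))) f"
    by (simp add: integrable_point_measure[OF a])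
  have "(\<integral>x. a x * f x \<partial>count_space UNIV) = (\<Sum>x | a x * f x \<noteq> 0. a x * f x)"
    using lebesgue_integral_count_space_finite_support[of UNIV "\<lambda>x. a x * f x"] fin by simp
  also have "\<dots> = (\<Sum>x\<in>F. a x * f x)"
    by (rule sum.mono_neutral_left) (use F in auto)
  finally show "integral\<^sup>L (point_measure UNIV (\<lambda>x. ennreal (a x))) f = (\<Sum>x\<in>F. a x * f x)"
    by (simp only: integral_point_measure[OF a])
qed

text \<open>Countability identifies the product of the counting measures with the counting measure
  on pairs; finite densities give \<sigma>-finiteness.\<close>

lemma pair_point_measure:
  fixes a :: "'a::countable \<Rightarrow> real" and b :: "'b::countable \<Rightarrow> real"
  assumes "\<And>x. a x \<ge> 0" "\<And>y. b y \<ge> 0"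
  shows "point_measure UNIV (\<lambda>x. ennreal (a x)) \<Otimes>\<^sub>M point_measure UNIV (\<lambda>y. ennreal (b y)) =
    point_measure UNIV (\<lambda>p. ennreal (a (fst p) * b (snd p)))"
proof -
  interpret B: sigma_finite_measure "count_space (UNIV :: 'b set)"
    by (rule sigma_finite_measure_count_space)
  have "sigma_finite_measure (density (count_space (UNIV :: 'b set)) (\<lambda>y. ennreal (b y)))"
    by (subst B.sigma_finite_iff_density_finite) (auto simp: AE_count_space)
  then have "point_measure UNIV (\<lambda>x. ennreal (a x)) \<Otimes>\<^sub>M point_measure UNIV (\<lambda>y. ennreal (b y)) =
      density (count_space UNIV \<Otimes>\<^sub>M count_space UNIV) (\<lambda>(x, y). ennreal (a x) * ennreal (b y))"
    unfolding point_measure_def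
    by (intro pair_measure_density) (auto intro: sigma_finite_measure_count_space)
  also have "count_space UNIV \<Otimes>\<^sub>M count_space UNIV = count_space (UNIV :: ('a \<times> 'b) set)"
    using pair_measure_countable[of "UNIV :: 'a set" "UNIV :: 'b set"] by simp
  also have "(\<lambda>(x, y). ennreal (a x) * ennreal (b y)) = (\<lambda>p. ennreal (a (fst p) * b (snd p)))"
    using assms by (auto simp: ennreal_mult case_prod_unfold)
  finally show ?thesis by (simp only: point_measure_def)
qed

section \<open>The integrals of the Flory equation\<close>

context flory_setup
begin

abbreviation law :: "real \<Rightarrow> (nat^'s) measure" where
  "law t \<equiv> point_measure UNIV (\<lambda>k. ennreal (dens t k))"

lemma pair_law:
  assumes "t \<ge> 0" "u \<ge> 0"
  shows "law t \<Otimes>\<^sub>M law u = point_measure UNIV (\<lambda>p. ennreal (dens t (fst p) * dens u (snd p)))"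
  by (rule pair_point_measure[OF dens_nonneg[OF assms(1)] dens_nonneg[OF assms(2)]])

text \<open>Each \<open>k\<close> in the support of \<open>f\<close> has finitely many splittings,
  so only finitely many pairs contribute.\<close>

lemma gain_integral:
  assumes f: "finite {k. f k \<noteq> 0}" and t: "t \<ge> 0"
  shows "integrable (law t \<Otimes>\<^sub>M law t) (\<lambda>(k, k'). f (k + k') * coag_kernel \<kappa> k k')"
    and "(\<integral>(k, k'). f (k + k') * coag_kernel \<kappa> k k' \<partial>(law t \<Otimes>\<^sub>M law t)) =
      (\<Sum>k | f k \<noteq> 0. f k * (\<Sum>p | fst p + snd p = k. coag_gain t p))"
proof -
  let ?F = "{p. f (fst p + snd p) \<noteq> 0}"
  have nn: "\<And>p. dens t (fst p) * dens t (snd p) \<ge> 0" using dens_nonneg[OF t] by simp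
  have F: "?F = (\<Union>k\<in>{k. f k \<noteq> 0}. {(j, l). j + l = k})" by auto
  have fin: "finite ?F" unfolding F using f finite_splittings by blast
  have zero: "dens t (fst p) * dens t (snd p) * (case p of (k, k') \<Rightarrow> f (k + k') * coag_kernel \<kappa> k k') = 0"
    if "p \<notin> ?F" for p using that by (simp add: case_prod_unfold)
  note fs = point_measure_finite_support[where a = "\<lambda>p. dens t (fst p) * dens t (snd p)"
      and f = "\<lambda>(k, k'). f (k + k') * coag_kernel \<kappa> k k'", OF nn fin zero]
  show "integrable (law t \<Otimes>\<^sub>M law t) (\<lambda>(k, k'). f (k + k') * coag_kernel \<kappa> k k')"
    unfolding pair_law[OF t t] by (rule fs(1))
  have "(\<integral>(k, k'). f (k + k') * coag_kernel \<kappa> k k' \<partial>(law t \<Otimes>\<^sub>M law t)) =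
      (\<Sum>p\<in>?F. f (fst p + snd p) * coag_gain t p)"
    unfolding pair_law[OF t t]
    by (rule trans[OF fs(2)], assumption, intro sum.cong refl) (simp only: case_prod_unfold mult_ac)
  also have "\<dots> = (\<Sum>k | f k \<noteq> 0. \<Sum>p\<in>{p \<in> ?F. fst p + snd p = k}. f (fst p + snd p) * coag_gain t p)"
    by (rule sum.group[OF fin f, symmetric]) auto
  also have "\<dots> = (\<Sum>k | f k \<noteq> 0. f k * (\<Sum>p | fst p + snd p = k. coag_gain t p))"
    unfolding sum_distrib_left by (intro sum.cong) auto
  finally show "(\<integral>(k, k'). f (k + k') * coag_kernel \<kappa> k k' \<partial>(law t \<Otimes>\<^sub>M law t)) =
      (\<Sum>k | f k \<noteq> 0. f k * (\<Sum>p | fst p + snd p = k. coag_gain t p))" .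
qed

lemma dens_0_axis: "dens 0 (axis r 1) = \<mu> $ r"
proof -
  have "(\<Sum>s\<in>UNIV. \<mu> $ s * indicator {axis s 1} (axis r (1::nat))) = (\<Sum>s\<in>UNIV. if s = r then \<mu> $ s else 0)"
    by (intro sum.cong) (auto simp: indicator_def axis_eq_axis simp del: One_nat_def)
  then show ?thesis by (simp add: component_density_0[OF sym] del: One_nat_def)
qed

text \<open>The initial measure sits on the finitely many unit vectors, and averaging the kernel
  over them with weights \<mu> gives \<open>collision_rate\<close>.\<close>

lemma loss_integral:
  assumes f: "finite {k. f k \<noteq> 0}" and t: "t \<ge> 0"
  shows "integrable (law t \<Otimes>\<^sub>M law 0) (\<lambda>(k, k'). f k * coag_kernel \<kappa> k k')"
    and "(\<integral>(k, k'). f k * coag_kernel \<kappa> k k' \<partial>(law t \<Otimes>\<^sub>M law 0)) =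
      (\<Sum>k | f k \<noteq> 0. f k * (dens t k * collision_rate \<kappa> \<mu> k))"
proof -
  let ?F = "{k. f k \<noteq> 0} \<times> range (\<lambda>r. axis r 1)"
  have nn: "\<And>p. dens t (fst p) * dens 0 (snd p) \<ge> 0" using dens_nonneg t by simp
  have fin: "finite ?F" using f by simp
  have d0: "dens 0 k = 0" if "k \<notin> range (\<lambda>r. axis r 1)" for k
    unfolding component_density_0[OF sym] using that by (intro sum.neutral) (auto simp: indicator_def)
  have zero: "dens t (fst p) * dens 0 (snd p) * (case p of (k, k') \<Rightarrow> f k * coag_kernel \<kappa> k k') = 0"
    if "p \<notin> ?F" for p using that d0[of "snd p"] by (cases p) auto
  note fs = point_measure_finite_support[where a = "\<lambda>p. dens t (fst p) * dens 0 (snd p)"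
      and f = "\<lambda>(k, k'). f k * coag_kernel \<kappa> k k'", OF nn fin zero]
  show "integrable (law t \<Otimes>\<^sub>M law 0) (\<lambda>(k, k'). f k * coag_kernel \<kappa> k k')"
    unfolding pair_law[OF t order_refl] by (rule fs(1))
  have rate: "(\<Sum>l\<in>range (\<lambda>r. axis r 1). dens 0 l * coag_kernel \<kappa> k l) = collision_rate \<kappa> \<mu> k" for k
  proof -
    have inj: "inj (\<lambda>r::'s. axis r (1::nat))" by (auto simp: inj_def axis_eq_axis)
    have "coag_kernel \<kappa> k (axis i 1) = (\<Sum>r\<in>UNIV. \<kappa> $ r $ i * real (k $ r))" for i
    proof -
      have "coag_kernel \<kappa> k (axis i 1) =
          (\<Sum>s\<in>UNIV. if s = i then \<Sum>r\<in>UNIV. \<kappa> $ r $ s * real (k $ r) else 0)"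
        unfolding coag_kernel_expand by (intro sum.cong) (auto simp: axis_def)
      then show ?thesis by simp
    qed
    then show ?thesis
      by (simp add: sum.reindex[OF inj] dens_0_axis collision_rate_expand mult.commute del: One_nat_def)
  qed
  have "(\<integral>(k, k'). f k * coag_kernel \<kappa> k k' \<partial>(law t \<Otimes>\<^sub>M law 0)) =
      (\<Sum>(k, l)\<in>?F. f k * dens t k * (dens 0 l * coag_kernel \<kappa> k l))"
    unfolding pair_law[OF t order_refl]
    by (rule trans[OF fs(2)], assumption, intro sum.cong refl) (simp only: case_prod_unfold mult_ac)
  also have "\<dots> = (\<Sum>k | f k \<noteq> 0. f k * dens t k * collision_rate \<kappa> \<mu> k)"
    by (simp only: sum.cartesian_product[symmetric] sum_distrib_left[symmetric] rate)
  finally show "(\<integral>(k, k'). f k * coag_kernel \<kappa> k k' \<partial>(law t \<Otimes>\<^sub>M law 0)) =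
      (\<Sum>k | f k \<noteq> 0. f k * (dens t k * collision_rate \<kappa> \<mu> k))"
    by (simp only: mult.assoc)
qed

text \<open>Here the second variable is unrestricted. The kernel is a finite sum of products of
  functions of one variable: \<open>f\<close> makes the first factor finitely supported, and
  \<open>moment_summable\<close> handles the second.\<close>

lemma self_loss_integrable:
  assumes f: "finite {k. f k \<noteq> 0}" and t: "t \<ge> 0"
  shows "integrable (law t \<Otimes>\<^sub>M law t) (\<lambda>(k, k'). f k * coag_kernel \<kappa> k k')"
proof -
  have nn: "\<And>p. dens t (fst p) * dens t (snd p) \<ge> 0" using dens_nonneg[OF t] by simp
  have "integrable (count_space UNIV) (\<lambda>(k, l). (dens t k * f k * real (k $ r)) * (dens t l * real (l $ s)))" for r s
  proof -
    have "Infinite_Set_Sum.abs_summable_on (\<lambda>k. dens t k * f k * real (k $ r)) {k. f k \<noteq> 0}" using f by simp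
    then have "Infinite_Set_Sum.abs_summable_on (\<lambda>k. dens t k * f k * real (k $ r)) UNIV"
      by (subst abs_summable_on_cong_neutral[where B = "{k. f k \<noteq> 0}"]) auto
    moreover have "Infinite_Set_Sum.abs_summable_on (\<lambda>l. dens t l * real (l $ s)) UNIV"
      unfolding abs_summable_on_def by (rule moment_summable[OF t])
    ultimately have "Infinite_Set_Sum.abs_summable_on
        (\<lambda>(k, l). (dens t k * f k * real (k $ r)) * (dens t l * real (l $ s))) (UNIV \<times> UNIV)"
      by (rule Infinite_Set_Sum.abs_summable_on_product[OF countableI_type countableI_type])
    then show ?thesis by (simp only: abs_summable_on_def UNIV_Times_UNIV)
  qed
  then have "integrable (count_space UNIV) (\<lambda>p. \<Sum>r\<in>UNIV. \<Sum>s\<in>UNIV. \<kappa> $ r $ s *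
      (case p of (k, l) \<Rightarrow> (dens t k * f k * real (k $ r)) * (dens t l * real (l $ s))))"
    by (intro Bochner_Integration.integrable_sum integrable_mult_right) simp
  also have "(\<lambda>p. \<Sum>r\<in>UNIV. \<Sum>s\<in>UNIV. \<kappa> $ r $ s *
      (case p of (k, l) \<Rightarrow> (dens t k * f k * real (k $ r)) * (dens t l * real (l $ s)))) =
     (\<lambda>p. dens t (fst p) * dens t (snd p) * (case p of (k, k') \<Rightarrow> f k * coag_kernel \<kappa> k k'))"
    by (auto simp: coag_kernel_def sum_distrib_left case_prod_unfold mult_ac)
  finally show ?thesis
    unfolding pair_law[OF t t] integrable_point_measure[where a = "\<lambda>p. dens t (fst p) * dens t (snd p)", OF nn] .
qed

lemma law_integral:
  assumes f: "finite {k. f k \<noteq> 0}" and t: "t \<ge> 0"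
  shows "integrable (law t) f" and "(\<integral>k. f k \<partial>law t) = (\<Sum>k | f k \<noteq> 0. dens t k * f k)"
proof -
  have zero: "dens t k * f k = 0" if "k \<notin> {k. f k \<noteq> 0}" for k using that by simp
  show "integrable (law t) f"
    by (rule point_measure_finite_support(1)[OF dens_nonneg[OF t] f zero])
  show "(\<integral>k. f k \<partial>law t) = (\<Sum>k | f k \<noteq> 0. dens t k * f k)"
    by (rule point_measure_finite_support(2)[OF dens_nonneg[OF t] f zero])
qed

theorem flory_solution_law:
  assumes L: "\<And>t. t \<ge> 0 \<Longrightarrow> L t = law t"
  shows "flory_solution \<kappa> (law 0) L"
  unfolding flory_solution_def
proof (intro conjI allI impI)
  show "L 0 = law 0" by (simp add: L)
next
  fix f :: "nat^'s \<Rightarrow> real" and t :: real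
  assume f: "finite {k. f k \<noteq> 0}" and t: "0 \<le> t"
  note Lt = L[OF t]
  show "integrable (L t) f" unfolding Lt by (rule law_integral[OF f t])
  show "integrable (L t \<Otimes>\<^sub>M L t) (\<lambda>(k, k'). f (k + k') * coag_kernel \<kappa> k k')"
    unfolding Lt by (rule gain_integral[OF f t])
  show "integrable (L t \<Otimes>\<^sub>M L t) (\<lambda>(k, k'). f k * coag_kernel \<kappa> k k')"
    unfolding Lt by (rule self_loss_integrable[OF f t])
  show "integrable (L t \<Otimes>\<^sub>M law 0) (\<lambda>(k, k'). f k * coag_kernel \<kappa> k k')"
    unfolding Lt by (rule loss_integral[OF f t])
  let ?D = "\<Sum>k | f k \<noteq> 0. (1 / 2 * (\<Sum>p | fst p + snd p = k. coag_gain t p) - dens t k * collision_rate \<kappa> \<mu> k) * f k"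
  have "((\<lambda>u. \<Sum>k | f k \<noteq> 0. dens u k * f k) has_real_derivative ?D) (at t within {0..})"
    by (rule has_field_derivative_at_within) (intro DERIV_sum DERIV_cmult_right dens_deriv)
  then have "((\<lambda>u. \<integral>k. f k \<partial>L u) has_real_derivative ?D) (at t within {0..})"
    by (rule has_field_derivative_transform_within[where d = 1]) (use t in \<open>simp_all add: L law_integral(2)[OF f]\<close>)
  moreover have "?D = 1 / 2 * (\<Sum>k | f k \<noteq> 0. f k * (\<Sum>p | fst p + snd p = k. coag_gain t p)) -
      (\<Sum>k | f k \<noteq> 0. f k * (dens t k * collision_rate \<kappa> \<mu> k))"
  proof -
    have "(\<Sum>k\<in>A. (1 / 2 * G k - d k * c k) * f k) = 1 / 2 * (\<Sum>k\<in>A. f k * G k) - (\<Sum>k\<in>A. f k * (d k * c k))"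
      for A and G d c :: "nat^'s \<Rightarrow> real"
      by (simp add: sum_subtractf sum_distrib_left algebra_simps)
    then show ?thesis .
  qed
  \<comment> \<open>The two self-interaction integrals cancel, so they never have to be
    evaluated.\<close>
  ultimately show "((\<lambda>u. \<integral>k. f k \<partial>L u) has_real_derivative
      1 / 2 * (\<integral>(k, k'). f (k + k') * coag_kernel \<kappa> k k' \<partial>(L t \<Otimes>\<^sub>M L t))
      - (\<integral>(k, k'). f k * coag_kernel \<kappa> k k' \<partial>(L t \<Otimes>\<^sub>M L t))
      - ((\<integral>(k, k'). f k * coag_kernel \<kappa> k k' \<partial>(L t \<Otimes>\<^sub>M law 0))
         - (\<integral>(k, k'). f k * coag_kernel \<kappa> k k' \<partial>(L t \<Otimes>\<^sub>M L t)))) (at t within {0..})"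
    unfolding Lt gain_integral(2)[OF f t] loss_integral(2)[OF f t] by (simp only: diff_diff_eq2 diff_add_cancel)
qed

end

text \<open>The first conjunct certifies that the description \<open>THE c\<close> in
  \<open>flory_measure\<close> denotes the intended vector whenever it is used.\<close>

theorem lemma2p7:
  fixes \<kappa> :: "real^'s^'s::finite" and \<mu> :: "real^'s"
  assumes "\<forall>r. \<mu> $ r > 0"
    and "(\<Sum>r\<in>UNIV. \<mu> $ r) = 1"
    and "\<forall>r s. \<kappa> $ r $ s \<ge> 0"
    and "transpose \<kappa> = \<kappa>"
    and "irreducible_matrix \<kappa>"
  shows "(\<forall>t>0. Sigma_norm (t *\<^sub>R \<kappa>) \<mu> > 1 \<longrightarrow> (\<exists>!c. is_dual_vector \<kappa> \<mu> t c)) \<and>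
         flory_solution \<kappa> (flory_initial \<mu>) (flory_measure \<kappa> \<mu>)"
proof -
  interpret flory_setup \<kappa> \<mu>
  proof
    show "transpose \<kappa> = \<kappa>" by (rule assms(4))
    show "\<kappa> $ r $ s \<ge> 0" for r s using assms(3) by blast
    show "\<mu> $ r > 0" for r using assms(1) by blast
  qed
  have dual: "\<exists>!c. is_dual_vector \<kappa> \<mu> t c" if "t > 0" "Sigma_norm (t *\<^sub>R \<kappa>) \<mu> > 1" for t
    using ex1_dual_vector[OF pos nonneg sym assms(5) that] .
  have init: "flory_initial \<mu> = law 0"
    by (simp add: flory_initial_def component_density_0[OF sym])
  have cluster: "cluster_measure \<kappa> t \<mu> = law t" for t
    by (simp add: cluster_measure_def cluster_weight_eq_component_density[OF sym])
  have "flory_measure \<kappa> \<mu> t = law t" if "t \<ge> 0" for t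
  proof (cases "t = 0 \<or> Sigma_norm (t *\<^sub>R \<kappa>) \<mu> \<le> 1")
    case True
    then show ?thesis by (auto simp: flory_measure_def init cluster)
  next
    case False
    then have "t > 0" "Sigma_norm (t *\<^sub>R \<kappa>) \<mu> > 1" using that by auto
    then have "is_dual_vector \<kappa> \<mu> t (THE c. is_dual_vector \<kappa> \<mu> t c)"
      by (rule theI'[OF dual])
    then have "cluster_measure \<kappa> t (THE c. is_dual_vector \<kappa> \<mu> t c) = cluster_measure \<kappa> t \<mu>"
      unfolding cluster_measure_def by (simp only: cluster_weight_dual)
    then show ?thesis using False by (simp add: flory_measure_def cluster)
  qed
  then have "flory_solution \<kappa> (law 0) (flory_measure \<kappa> \<mu>)" by (rule flory_solution_law)
  then show ?thesis using dual init by simp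
qed

end
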